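(* Let $m$ be a positive integer and $0<x<2\pi$. Then $$\sum_{n=1}^\infty\frac{\cos nx}{n^{2m-1}}=\frac{(-1)^{m-1}(2\pi)^{2m-2}}{(2m-2)!}\Big(\zeta'\Big(2-2m,1-\frac x{2\pi}\Big)+\zeta'\Big(2-2m,\frac x{2\pi}\Big)\Big).$$
   Context: For $0<a\le 1$, $\zeta(s,a)$ denotes the Hurwitz zeta function, defined for $\Re s>1$ by $\zeta(s,a)=\sum_{k=0}^\infty (k+a)^{-s}$ and extended by analytic continuation to all complex $s\neq 1$. Throughout, $\zeta'(s,a)$ denotes the partial derivative $\frac{\partial}{\partial s}\zeta(s,a)$ with respect to the first variable $s$. *)

theory Defs
  imports "HOL-Complex_Analysis.Complex_Analysis"
begin

text \<open>Hurwitz zeta function for 0 < a: the (unique, by the identity theorem on the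
connected open set -{1}) holomorphic function on the complex plane minus 1 that
agrees with the Dirichlet series sum_{k>=0} (k+a)^(-s) for Re s > 1.\<close>
definition hurwitz_zeta :: "real \<Rightarrow> complex \<Rightarrow> complex" where
  "hurwitz_zeta a = (SOME f. f holomorphic_on (- {1}) \<and>
      (\<forall>s. 1 < Re s \<longrightarrow> f s = (\<Sum>k. complex_of_real (real k + a) powr (- s))))"

definition hurwitz_zeta_deriv :: "complex \<Rightarrow> real \<Rightarrow> complex" where
  "hurwitz_zeta_deriv s a = deriv (hurwitz_zeta a) s"

end

(*
  For 0 < a < 1 put P(s, a) = zeta(s, a) + zeta(s, 1 - a). The functional equation is avoided: at the
  points s = -2k both P'(s, a) and the cosine series of exponent 2k + 1 are identified through a
  second order differential equation in a. From d/da zeta(s, a) = - s zeta(s + 1, a) one gets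
  P_aa(s, a) = s (s + 1) P(s + 2, a), and the cosine series satisfy the matching recursion. A
  function on (0, 1) with vanishing second derivative is zero as soon as it is symmetric under
  a -> 1 - a and satisfies the duplication relation h(a) + h(a + 1/2) = q h(2a) with q different
  from 2: symmetry kills the slope and duplication kills the constant. This shows P(-2k, a) = 0 and
  then, by induction on k, the claim. The case k = 0 compares both sides with
  ln Gamma(a) + ln Gamma(1 - a), using Abel summation and the reflection formula.
*)
theory Submission
  imports Defs
begin

section \<open>The Hurwitz series\<close>

text \<open>At s = 0 the first a-derivative of P passes through \<open>s + 1 = 1\<close>, the pole
  of zeta. So the work is done with the entire function W(s, a) = (s - 1) zeta(s, a), which
  satisfies W_a(s, a) = - (s - 1) W(s + 1, a) for every s. Differentiating the symmetrized second
  order equation in s gives a second derivative with two terms: (2 s - 1) times the symmetrized W at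
  s + 2, and (s - 1) s times the symmetrized s-derivative at s + 2. For s = -2k with k > 0 the first
  term vanishes, which is why the vanishing of P is settled beforehand; at s = 0 the second vanishes
  and a trigamma sum remains, which is why the base case involves Gamma. Duplication multiplies by
  2^s on the zeta side and by 2^(1 - j) on the series side. For s = -2k and j = 2k + 1 these factors
  coincide, so differences of the two sides obey one duplication relation. Derivatives in a are
  always extracted from integral identities: these can be continued analytically in s,
  differentiated in s and obtained by summing termwise, which is delicate for the conditionally
  convergent series of exponent 1.\<close>

lemma sums_integral_uniform_limit:
  fixes f :: "nat \<Rightarrow> real \<Rightarrow> complex"
  assumes lim: "uniform_limit {a..b} (\<lambda>n t. \<Sum>k<n. f k t) g sequentially"
    and cont: "\<And>k. continuous_on {a..b} (f k)"
  shows "(\<lambda>k. integral {a..b} (f k)) sums integral {a..b} g"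
proof -
  obtain I J where I: "\<And>n. ((\<lambda>t. \<Sum>k<n. f k t) has_integral I n) {a..b}"
    and J: "(g has_integral J) {a..b}" and IJ: "I \<longlonglongrightarrow> J"
    by (rule uniform_limit_integral[OF lim]) (auto intro!: continuous_on_sum cont)
  have "I n = (\<Sum>k<n. integral {a..b} (f k))" for n
    using I[of n] by (subst integral_sum [symmetric])
      (auto intro!: integrable_continuous_interval cont simp: integral_unique)
  then have "I = (\<lambda>n. \<Sum>k<n. integral {a..b} (f k))" by blast
  then show ?thesis
    using IJ J by (auto simp: sums_def integral_unique)
qed

lemma continuous_on_slice:
  assumes "continuous_on (S \<times> T) (\<lambda>p. f (fst p) (snd p))" "s \<in> S" "A \<subseteq> T"
  shows "continuous_on A (f s)"
proof -
  have "continuous_on A ((\<lambda>p. f (fst p) (snd p)) \<circ> (\<lambda>t. (s, t)))"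
    using assms
    by (intro continuous_on_compose continuous_on_subset[OF assms(1)]
        continuous_on_Pair continuous_on_const continuous_on_id) auto
  then show ?thesis by (simp add: o_def)
qed

definition hurwitz_series :: "complex \<Rightarrow> real \<Rightarrow> complex" where
  "hurwitz_series s a = (\<Sum>k. complex_of_real (real k + a) powr (- s))"

text \<open>For \<open>k > 0\<close> the bound \<open>real k powr (-\<sigma>)\<close> depends
  neither on \<open>s\<close> nor on \<open>a\<close>, so convergence is uniform in both jointly.
  The term \<open>k = 0\<close> is unbounded as \<open>a\<close> tends to 0; hence the M-test with
  an eventual bound.\<close>

lemma uniform_limit_hurwitz_series:
  assumes "1 < \<sigma>"
  shows "uniform_limit ({s. \<sigma> \<le> Re s} \<times> {0<..})
     (\<lambda>n p. \<Sum>k<n. complex_of_real (real k + snd p) powr (- fst p))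
     (\<lambda>p. hurwitz_series (fst p) (snd p)) sequentially"
  unfolding hurwitz_series_def
proof (rule Weierstrass_m_test_ev)
  show "\<forall>\<^sub>F k in sequentially. \<forall>p\<in>{s. \<sigma> \<le> Re s} \<times> {0<..}.
      cmod (complex_of_real (real k + snd p) powr - fst p) \<le> real k powr (-\<sigma>)"
    using eventually_gt_at_top[of 0]
  proof eventually_elim
    case (elim k)
    have "cmod (complex_of_real (real k + a) powr - s) \<le> real k powr (-\<sigma>)"
      if "\<sigma> \<le> Re s" "0 < a" for s a
    proof -
      have "cmod (complex_of_real (real k + a) powr - s) = (real k + a) powr (- Re s)"
        using that by (subst norm_powr_real_powr) auto
      also have "\<dots> \<le> (real k + a) powr (- \<sigma>)"
        using that elim by (intro powr_mono) auto
      also have "\<dots> \<le> real k powr (- \<sigma>)"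
        using that elim assms by (intro powr_mono2') auto
      finally show ?thesis .
    qed
    then show ?case by auto
  qed
  show "summable (\<lambda>k. real k powr - \<sigma>)"
    using assms by (simp add: summable_real_powr_iff)
qed

lemma hurwitz_series_sums:
  assumes "1 < Re s" "0 < a"
  shows "(\<lambda>k. complex_of_real (real k + a) powr (- s)) sums hurwitz_series s a"
  using tendsto_uniform_limitI[OF uniform_limit_hurwitz_series[OF assms(1)], of "(s, a)"] assms
  by (simp add: sums_def)

lemma continuous_on_hurwitz_term:
  "continuous_on (UNIV \<times> {0<..}) (\<lambda>p. complex_of_real (real k + snd p) powr (- fst p))"
  by (intro continuous_on_powr_complex continuous_intros) (auto simp: complex_eq_iff)

text \<open>Serves to glue: convergence is uniform only for \<open>Re s\<close> bounded away from
  1.\<close>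

lemma Re_half_plane_Un:
  "{s. c < Re s} = (\<Union>\<sigma>\<in>{c<..}. {s. \<sigma> < Re s})"
  by (auto intro: less_trans dest: dense)

lemma continuous_on_hurwitz_series:
  "continuous_on ({s. 1 < Re s} \<times> {0<..}) (\<lambda>p. hurwitz_series (fst p) (snd p))"
proof -
  have "continuous_on ({s. \<sigma> < Re s} \<times> {0<..}) (\<lambda>p. hurwitz_series (fst p) (snd p))"
    if "1 < \<sigma>" for \<sigma>
  proof -
    have "continuous_on ({s. \<sigma> \<le> Re s} \<times> {0<..}) (\<lambda>p. hurwitz_series (fst p) (snd p))"
      by (rule uniform_limit_theorem[OF _ uniform_limit_hurwitz_series[OF that]])
        (auto intro!: always_eventually continuous_on_sum
            continuous_on_subset[OF continuous_on_hurwitz_term] simp del: of_real_add)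
    then show ?thesis
      by (rule continuous_on_subset) auto
  qed
  then have "continuous_on (\<Union>\<sigma>\<in>{1<..}. {s. \<sigma> < Re s} \<times> {0<..})
     (\<lambda>p. hurwitz_series (fst p) (snd p))"
    by (intro continuous_on_open_UN) (auto intro!: open_Times open_halfspace_Re_gt)
  moreover have "(\<Union>\<sigma>\<in>{1<..}. {s. \<sigma> < Re s} \<times> {0<..}) = {s. 1 < Re s} \<times> {0::real<..}"
    by (subst Re_half_plane_Un) auto
  ultimately show ?thesis by simp
qed

lemma holomorphic_on_hurwitz_series:
  assumes "0 < a"
  shows "(\<lambda>s. hurwitz_series s a) holomorphic_on {s. 1 < Re s}"
proof (rule holomorphic_uniform_sequence)
  show "(\<lambda>s. \<Sum>k<n. complex_of_real (real k + a) powr (- s)) holomorphic_on {s. 1 < Re s}" for n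
    by (intro holomorphic_intros) (use assms in \<open>auto simp: complex_nonpos_Reals_iff\<close>)
next
  fix s :: complex assume s: "s \<in> {s. 1 < Re s}"
  \<comment> \<open>Half the distance to the line \<open>Re s = 1\<close>, so the closed disc stays
    at distance \<open>d\<close> from it.\<close>
  define d where "d = (Re s - 1) / 2"
  have d: "0 < d" "cball s d \<subseteq> {z. 1 + d \<le> Re z}"
  proof -
    show "0 < d" using s by (simp add: d_def)
    have "1 + d \<le> Re z" if "cmod (s - z) \<le> d" for z
      using abs_Re_le_cmod[of "s - z"] that unfolding d_def by (simp add: field_simps)
    then show "cball s d \<subseteq> {z. 1 + d \<le> Re z}" by (auto simp: dist_norm)
  qed
  have "uniform_limit (cball s d) (\<lambda>n z. \<Sum>k<n. complex_of_real (real k + a) powr (- z))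
     (\<lambda>z. hurwitz_series z a) sequentially"
    using uniform_limit_compose'[OF uniform_limit_hurwitz_series[of "1 + d"], of "\<lambda>z. (z, a)" "cball s d"]
      d assms by auto
  then show "\<exists>d>0. cball s d \<subseteq> {s. 1 < Re s} \<and> uniform_limit (cball s d)
       (\<lambda>n z. \<Sum>k<n. complex_of_real (real k + a) powr (- z)) (\<lambda>z. hurwitz_series z a) sequentially"
    using d by (intro exI[of _ d]) auto
qed (auto intro: open_halfspace_Re_gt)

text \<open>The weight is constant for the derivative in the second argument and linear for the
  continuation step.\<close>

lemma hurwitz_weighted_integral_sums:
  assumes s: "1 < Re s" and a: "0 < a" "a \<le> b" and w: "continuous_on {a..b} w"
  shows "(\<lambda>k. integral {a..b} (\<lambda>t. w t * complex_of_real (real k + t) powr (- s))) sums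
           integral {a..b} (\<lambda>t. w t * hurwitz_series s t)"
proof (rule sums_integral_uniform_limit)
  have h: "continuous_on {a..b} (\<lambda>t. hurwitz_series s t)"
    by (rule continuous_on_slice[OF continuous_on_hurwitz_series]) (use s a in auto)
  have "uniform_limit {a..b} (\<lambda>n t. \<Sum>k<n. complex_of_real (real k + t) powr (- s))
     (\<lambda>t. hurwitz_series s t) sequentially"
    using uniform_limit_compose'[OF uniform_limit_hurwitz_series[OF s], of "\<lambda>t. (s, t)" "{a..b}"] a
    by auto
  moreover have "bounded (w ` {a..b})" "bounded ((\<lambda>t. hurwitz_series s t) ` {a..b})"
    using w h by (auto intro!: compact_imp_bounded compact_continuous_image)
  ultimately have "uniform_limit {a..b}
     (\<lambda>n t. w t * (\<Sum>k<n. complex_of_real (real k + t) powr (- s)))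
     (\<lambda>t. w t * hurwitz_series s t) sequentially"
    by (intro bounded_bilinear.bounded_uniform_limit[OF bounded_bilinear_mult] uniform_limit_const)
  then show "uniform_limit {a..b}
     (\<lambda>n t. \<Sum>k<n. w t * complex_of_real (real k + t) powr (- s))
     (\<lambda>t. w t * hurwitz_series s t) sequentially"
    by (simp add: sum_distrib_left)
  show "continuous_on {a..b} (\<lambda>t. w t * complex_of_real (real k + t) powr (- s))" for k
    using w a by (intro continuous_on_powr_complex continuous_intros) (auto simp: complex_eq_iff)
qed

lemma has_vector_derivative_shifted_powr:
  assumes "0 < t + c"
  shows "((\<lambda>t. complex_of_real (c + t) powr z) has_vector_derivative
           z * complex_of_real (c + t) powr (z - 1)) (at t within A)"
proof -
  have "((\<lambda>w. (of_real c + w) powr z) has_field_derivative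
          z * (of_real c + of_real t) powr (z - 1)) (at (of_real t))"
    using assms by (auto intro!: derivative_eq_intros simp: complex_nonpos_Reals_iff add_ac)
  then show ?thesis
    using has_vector_derivative_real_field[of "\<lambda>w. (of_real c + w) powr z"] by auto
qed

text \<open>Integrated form of d/da zeta(s, a) = - s zeta(s + 1, a): each term
  \<open>(k + t) powr (- s - 1)\<close> has the primitive \<open>(k + t) powr (- s) / (- s)\<close>,
  and the integrals are summed.\<close>

lemma hurwitz_series_diff:
  assumes s: "1 < Re s" and ab: "0 < a" "a \<le> b"
  shows "hurwitz_series s b - hurwitz_series s a =
           - s * integral {a..b} (\<lambda>t. hurwitz_series (s + 1) t)"
proof -
  have "((\<lambda>t. complex_of_real (real k + t) powr (- (s + 1))) has_integral
      (complex_of_real (real k + b) powr (- s) / (- s) - complex_of_real (real k + a) powr (- s) / (- s)))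
      {a..b}" for k
  proof (rule fundamental_theorem_of_calculus)
    fix t assume t: "t \<in> {a..b}"
    have "((\<lambda>t. inverse (- s) * complex_of_real (real k + t) powr (- s)) has_vector_derivative
       inverse (- s) * (- s * complex_of_real (real k + t) powr (- s - 1))) (at t within {a..b})"
      using t ab by (intro has_vector_derivative_mult_right has_vector_derivative_shifted_powr) auto
    then show "((\<lambda>t. complex_of_real (real k + t) powr (- s) / (-s)) has_vector_derivative
       complex_of_real (real k + t) powr (- (s + 1))) (at t within {a..b})"
      using s by (auto simp: field_simps minus_diff_commute split: if_splits)
  qed (use ab in auto)
  then have int: "integral {a..b} (\<lambda>t. complex_of_real (real k + t) powr (- (s + 1))) =
      (complex_of_real (real k + b) powr (- s) - complex_of_real (real k + a) powr (- s)) / (- s)" for k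
    by (simp add: integral_unique diff_divide_distrib)
  have "(\<lambda>k. integral {a..b} (\<lambda>t. 1 * complex_of_real (real k + t) powr (- (s + 1)))) sums
     integral {a..b} (\<lambda>t. 1 * hurwitz_series (s + 1) t)"
    using s ab by (intro hurwitz_weighted_integral_sums) auto
  moreover have "(\<lambda>k. (complex_of_real (real k + b) powr (- s) -
       complex_of_real (real k + a) powr (- s)) / (- s)) sums
     ((hurwitz_series s b - hurwitz_series s a) / (- s))"
    using s ab by (intro sums_divide sums_diff hurwitz_series_sums) auto
  ultimately have "integral {a..b} (\<lambda>t. hurwitz_series (s + 1) t) =
      (hurwitz_series s b - hurwitz_series s a) / (- s)"
    using sums_unique2 by (simp only: int mult_1_left)
  moreover have "s \<noteq> 0" using s by auto
  ultimately show ?thesis by simp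
qed

text \<open>One integration by parts writes the k-th term as a weighted integral of
  \<open>s * (k + t) powr (- s - 1)\<close> plus the integral of \<open>(k + t) powr (- s)\<close>
  over \<open>[a, a + 1]\<close>; the latter integrals telescope to
  \<open>a powr (1 - s) / (s - 1)\<close>. On the right the series occurs only at
  \<open>s + 1\<close>, which gains one unit of \<open>Re s\<close>.\<close>

lemma hurwitz_series_regularized:
  assumes s: "1 < Re s" and a: "0 < a"
  shows "(s - 1) * hurwitz_series s a = complex_of_real a powr (1 - s) +
     (s - 1) * integral {0..1} (\<lambda>u. complex_of_real (1 - u) * (s * hurwitz_series (s + 1) (a + u)))"
proof -
  define p where "p k t z = complex_of_real (real k + t) powr z" for k t z
  define J where "J k = integral {a..a+1} (\<lambda>t. (complex_of_real (a + 1 - t) * s) * p k t (- (s + 1)))" for k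
  have J: "(s - 1) * J k = (s - 1) * p k a (- s) - (p k a (1 - s) - p (Suc k) a (1 - s))" for k
  proof -
    \<comment> \<open>The primitive comes from integration by parts; the weight
      \<open>a + 1 - t\<close> vanishes at the upper end and equals 1 at the lower one.\<close>
    have "((\<lambda>t. (complex_of_real (a + 1 - t) * s) * p k t (- (s + 1))) has_integral
        (- (complex_of_real (a + 1 - (a + 1)) * p k (a+1) (- s)) - p k (a+1) (1 - s) / (1 - s)) -
        (- (complex_of_real (a + 1 - a) * p k a (- s)) - p k a (1 - s) / (1 - s))) {a..a+1}"
    proof (rule fundamental_theorem_of_calculus)
      fix t assume t: "t \<in> {a..a+1}"
      have "((\<lambda>t. - (complex_of_real (a + 1 - t) * p k t (- s)) - p k t (1 - s) / (1 - s))
         has_vector_derivative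
         - (complex_of_real (a + 1 - t) * (- s * p k t (- s - 1)) + complex_of_real (0 - 1) * p k t (- s))
         - ((1 - s) * p k t (1 - s - 1)) / (1 - s)) (at t within {a..a+1})"
        unfolding p_def
        by (intro has_vector_derivative_diff has_vector_derivative_minus has_vector_derivative_mult
            has_vector_derivative_divide has_vector_derivative_shifted_powr has_vector_derivative_of_real)
          (use t a in \<open>auto intro!: derivative_eq_intros\<close>)
      moreover have "- (complex_of_real (a + 1 - t) * (- s * p k t (- s - 1)) + complex_of_real (0 - 1) * p k t (- s))
         - ((1 - s) * p k t (1 - s - 1)) / (1 - s) = (complex_of_real (a + 1 - t) * s) * p k t (- (s + 1))"
      proof -
        have "((1 - s) * p k t (1 - s - 1)) / (1 - s) = p k t (- s)"
          using s by auto
        moreover have "- (s + 1) = - s - 1" by simp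
        ultimately show ?thesis by (simp only:) (simp add: algebra_simps del: of_real_add of_real_diff)
      qed
      ultimately show "((\<lambda>t. - (complex_of_real (a + 1 - t) * p k t (- s)) - p k t (1 - s) / (1 - s))
         has_vector_derivative (complex_of_real (a + 1 - t) * s) * p k t (- (s + 1))) (at t within {a..a+1})"
        by metis
    qed auto
    then have "J k = p k a (- s) + (p k a (1 - s) - p k (a+1) (1 - s)) / (1 - s)"
      by (simp add: J_def integral_unique diff_divide_distrib)
    moreover have "p k (a+1) (1 - s) = p (Suc k) a (1 - s)"
      by (simp add: p_def add_ac)
    moreover have "1 - s \<noteq> 0" using s by auto
    then have "(s - 1) * (x / (1 - s)) = - x" for x
      by (simp add: field_simps)
    ultimately show ?thesis by (simp add: distrib_left)
  qed
  \<comment> \<open>The boundary term of the telescoping sum at infinity; \<open>1 < Re s\<close>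
    makes it vanish.\<close>
  have "(\<lambda>k. p k a (1 - s)) \<longlonglongrightarrow> 0"
  proof (rule tendsto_norm_zero_cancel)
    have "(\<lambda>k. (real k + a) powr (1 - Re s)) \<longlonglongrightarrow> 0"
      using s filterlim_tendsto_add_at_top[OF tendsto_const filterlim_real_sequentially, of a]
      by (intro tendsto_neg_powr) (auto simp: add.commute)
    moreover have "norm (p k a (1 - s)) = (real k + a) powr (1 - Re s)" for k
      using a unfolding p_def by (subst norm_powr_real_powr) auto
    ultimately show "(\<lambda>k. norm (p k a (1 - s))) \<longlonglongrightarrow> 0" by simp
  qed
  from telescope_sums'[OF this]
  have "(\<lambda>k. p k a (1 - s) - p (Suc k) a (1 - s)) sums (complex_of_real a powr (1 - s))"
    by (simp add: p_def)
  moreover have "(\<lambda>k. (s - 1) * p k a (- s)) sums ((s - 1) * hurwitz_series s a)"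
    unfolding p_def using s a by (intro sums_mult hurwitz_series_sums)
  ultimately have "(\<lambda>k. (s - 1) * J k) sums ((s - 1) * hurwitz_series s a - complex_of_real a powr (1 - s))"
    unfolding J by (intro sums_diff)
  moreover have "(\<lambda>k. (s - 1) * J k) sums
     ((s - 1) * integral {a..a+1} (\<lambda>t. (complex_of_real (a + 1 - t) * s) * hurwitz_series (s + 1) t))"
    unfolding J_def p_def using s a
    by (intro sums_mult hurwitz_weighted_integral_sums) (auto intro!: continuous_intros)
  ultimately have "(s - 1) * hurwitz_series s a - complex_of_real a powr (1 - s) =
     (s - 1) * integral {a..a+1} (\<lambda>t. (complex_of_real (a + 1 - t) * s) * hurwitz_series (s + 1) t)"
    using sums_unique2 by blast
  \<comment> \<open>Moving to the fixed interval \<open>[0, 1]\<close> puts \<open>a\<close> into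
    the integrand alone, the form to which continuity of parameter integrals applies.\<close>
  also have "integral {a..a+1} (\<lambda>t. (complex_of_real (a + 1 - t) * s) * hurwitz_series (s + 1) t) =
      integral {0..1} (\<lambda>u. complex_of_real (1 - u) * (s * hurwitz_series (s + 1) (a + u)))"
  proof -
    have "(\<lambda>t. (complex_of_real (a + 1 - t) * s) * hurwitz_series (s + 1) t) integrable_on {a..a+1}"
      using s a by (intro integrable_continuous_interval continuous_intros
        continuous_on_slice[OF continuous_on_hurwitz_series]) auto
    then have "((\<lambda>t. (complex_of_real (a + 1 - t) * s) * hurwitz_series (s + 1) t) has_integral
      integral {a..a+1} (\<lambda>t. (complex_of_real (a + 1 - t) * s) * hurwitz_series (s + 1) t)) {a..a+1}"
      by (rule integrable_integral)
    from has_integral_affinity[OF this[folded cbox_interval], of 1 a]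
    have "((\<lambda>u. complex_of_real (1 - u) * (s * hurwitz_series (s + 1) (a + u))) has_integral
      integral {a..a+1} (\<lambda>t. (complex_of_real (a + 1 - t) * s) * hurwitz_series (s + 1) t)) {0..1}"
      by (simp add: add.commute mult.assoc)
    then show ?thesis by (simp only: integral_unique)
  qed
  finally show ?thesis by (simp add: algebra_simps)
qed

section \<open>Analytic continuation of the Hurwitz series\<close>

text \<open>Cauchy's formula turns the derivative into an integral over a compact parameter range,
  whose integrand is jointly continuous. The Leibniz rule below asks for this joint
  continuity.\<close>

lemma continuous_on_deriv_param:
  fixes f :: "complex \<Rightarrow> 'a::topological_space \<Rightarrow> complex"
  assumes S: "open S" and A: "open A"
    and cont: "continuous_on (S \<times> A) (\<lambda>p. f (fst p) (snd p))"
    and hol: "\<And>t. t \<in> A \<Longrightarrow> (\<lambda>s. f s t) holomorphic_on S"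
  shows "continuous_on (S \<times> A) (\<lambda>p. deriv (\<lambda>s. f s (snd p)) (fst p))"
proof -
  have "\<exists>r>0. continuous_on (ball s0 r \<times> A) (\<lambda>p. deriv (\<lambda>s. f s (snd p)) (fst p))"
    if "s0 \<in> S" for s0
  proof -
    obtain R where R: "R > 0" "cball s0 R \<subseteq> S"
      using S \<open>s0 \<in> S\<close> open_contains_cball by blast
    \<comment> \<open>One radius for all centres: a circle of radius \<open>R / 2\<close> about a
      point of \<open>ball s0 r\<close> stays in \<open>cball s0 R\<close>.\<close>
    define r where "r = R / 2"
    have sub: "cball s r \<subseteq> S" if "s \<in> ball s0 r" for s
    proof -
      have "cball s r \<subseteq> cball s0 R"
        using that by (auto simp: r_def cball_subset_cball_iff dist_commute)
      then show "cball s r \<subseteq> S" using R by blast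
    qed
    \<comment> \<open>The circle about 0, so that \<open>s + e x\<close> runs through the circle
      about \<open>s\<close>; the last factor of \<open>F\<close> is the derivative of this
      parametrization.\<close>
    define e where "e x = complex_of_real r * exp (2 * of_real pi * \<i> * of_real x)" for x
    define F where "F p x = f (fst p + e x) (snd p) / (e x)\<^sup>2 * (2 * of_real pi * \<i> * e x)" for p x
    have r0: "r > 0" using R by (simp add: r_def)
    have e0: "e x \<noteq> 0" "cmod (e x) = r" for x
      using r0 by (auto simp: e_def norm_mult)
    have eq: "deriv (\<lambda>s. f s (snd p)) (fst p) = 1 / (2 * of_real pi * \<i>) * integral (cbox 0 1) (F p)"
      if p: "p \<in> ball s0 r \<times> A" for p
    proof -
      obtain s t where st: "p = (s, t)" by fastforce
      have h: "(\<lambda>s. f s t) holomorphic_on cball s r"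
        using hol[of t] sub[of s] p st by (intro holomorphic_on_subset[OF hol]) auto
      then have "((\<lambda>s. f s t) has_field_derivative
         (1 / (2 * of_real pi * \<i>) * contour_integral (circlepath s r) (\<lambda>u. f u t / (u - s)^2))) (at s)"
        using r0 holomorphic_on_subset[OF h ball_subset_cball]
        by (intro Cauchy_derivative_integral_circlepath(2) holomorphic_on_imp_continuous_on) auto
      then have "deriv (\<lambda>s. f s t) s =
         1 / (2 * of_real pi * \<i>) * contour_integral (circlepath s r) (\<lambda>u. f u t / (u - s)^2)"
        by (rule DERIV_imp_deriv)
      also have "contour_integral (circlepath s r) (\<lambda>u. f u t / (u - s)^2) = integral {0..1} (F p)"
        unfolding contour_integral_integral F_def st
        by (intro integral_cong)
          (simp add: vector_derivative_circlepath, simp add: circlepath e_def mult_ac)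
      finally show ?thesis by (simp add: st)
    qed
    have "continuous_on ((ball s0 r \<times> A) \<times> cbox 0 1) (\<lambda>q. f (fst (fst q) + e (snd q)) (snd (fst q)))"
    proof -
      have "continuous_on ((ball s0 r \<times> A) \<times> cbox 0 1)
         ((\<lambda>p. f (fst p) (snd p)) \<circ> (\<lambda>q. (fst (fst q) + e (snd q), snd (fst q))))"
      proof (intro continuous_on_compose continuous_on_subset[OF cont])
        show "continuous_on ((ball s0 r \<times> A) \<times> cbox 0 1) (\<lambda>q. (fst (fst q) + e (snd q), snd (fst q)))"
          unfolding e_def by (intro continuous_intros)
        have "s + e x \<in> S" if "s \<in> ball s0 r" for s x
          using sub[OF that] e0[of x] by (auto simp: dist_norm)
        then show "(\<lambda>q. (fst (fst q) + e (snd q), snd (fst q))) ` ((ball s0 r \<times> A) \<times> cbox 0 1) \<subseteq> S \<times> A"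
          by auto
      qed
      then show ?thesis by (simp add: o_def)
    qed
    then have "continuous_on ((ball s0 r \<times> A) \<times> cbox 0 1) (\<lambda>(p, x). F p x)"
      unfolding F_def case_prod_unfold using e0(1)
      by (intro continuous_intros) (auto simp: e_def intro!: continuous_intros)
    from integral_continuous_on_param[OF this]
    have "continuous_on (ball s0 r \<times> A) (\<lambda>p. 1 / (2 * of_real pi * \<i>) * integral (cbox 0 1) (F p))"
      by (intro continuous_intros)
    then have "continuous_on (ball s0 r \<times> A) (\<lambda>p. deriv (\<lambda>s. f s (snd p)) (fst p))"
      using eq by (simp cong: continuous_on_cong)
    then show ?thesis using r0 by blast
  qed
  then obtain r where r: "\<And>s. s \<in> S \<Longrightarrow> r s > 0"
      "\<And>s. s \<in> S \<Longrightarrow> continuous_on (ball s (r s) \<times> A) (\<lambda>p. deriv (\<lambda>s. f s (snd p)) (fst p))"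
    by metis
  have "continuous_on (\<Union>s\<in>S. ball s (r s) \<times> A) (\<lambda>p. deriv (\<lambda>s. f s (snd p)) (fst p))"
    using r(2) A by (intro continuous_on_open_UN) (auto intro!: open_Times)
  then show ?thesis
    by (rule continuous_on_subset) (use r(1) in force)
qed

text \<open>The Leibniz rule wants a convex \<open>S\<close>; the open \<open>A\<close> around the
  compact interval makes \<open>continuous_on_deriv_param\<close> applicable.\<close>

lemma integral_param_has_field_derivative:
  fixes f :: "complex \<Rightarrow> real \<Rightarrow> complex"
  assumes S: "open S" "convex S" and A: "open A" "{a..b} \<subseteq> A"
    and cont: "continuous_on (S \<times> A) (\<lambda>p. f (fst p) (snd p))"
    and hol: "\<And>t. t \<in> A \<Longrightarrow> (\<lambda>s. f s t) holomorphic_on S"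
    and s: "s \<in> S"
  shows "((\<lambda>s. integral {a..b} (f s)) has_field_derivative
           integral {a..b} (\<lambda>t. deriv (\<lambda>s. f s t) s)) (at s)"
proof -
  have "((\<lambda>s. integral (cbox a b) (f s)) has_field_derivative
           integral (cbox a b) (\<lambda>t. deriv (\<lambda>s. f s t) s)) (at s within S)"
  proof (rule leibniz_rule_field_derivative[where f = f and fx = "\<lambda>s t. deriv (\<lambda>s. f s t) s", OF _ _ _ s S(2)])
    fix z t assume "z \<in> S" and t: "t \<in> cbox a b"
    moreover have "t \<in> A" using t A(2) by auto
    ultimately show "((\<lambda>s. f s t) has_field_derivative deriv (\<lambda>s. f s t) z) (at z within S)"
      using has_field_derivative_at_within[OF holomorphic_derivI[OF hol S(1)]] by blast
  next
    fix z assume z: "z \<in> S"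
    show "f z integrable_on cbox a b"
      unfolding cbox_interval
      by (rule integrable_continuous_interval[OF continuous_on_slice[where f = f, OF cont z A(2)]])
  next
    show "continuous_on (S \<times> cbox a b) (\<lambda>(x, t). deriv (\<lambda>s. f s t) x)"
      unfolding case_prod_unfold
    proof (rule continuous_on_subset[of "S \<times> A"])
      show "continuous_on (S \<times> A) (\<lambda>p. deriv (\<lambda>s. f s (snd p)) (fst p))"
        by (rule continuous_on_deriv_param[where f = f, OF S(1) A(1) cont hol])
      show "S \<times> cbox a b \<subseteq> S \<times> A"
        using A(2) by (intro Sigma_mono) simp_all
    qed
  qed
  then show ?thesis by (simp only: at_within_open[OF s S(1)] cbox_interval)
qed

text \<open>Continues \<open>(s - 1) \<zeta>(s, a)\<close> from \<open>Re s > 1\<close> to \<open>Re s > 1 - n\<close>. The recursion is the first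
  step of Euler--Maclaurin summation: integrate \<open>\<partial>\<zeta>(s, a)/\<partial>a = - s \<zeta>(s + 1, a)\<close> twice and use
  \<open>\<integral> \<zeta>(s, t) dt = a powr (1 - s) / (s - 1)\<close> over \<open>[a, a + 1]\<close>.\<close>

primrec hurwitz_reg_aux :: "nat \<Rightarrow> complex \<Rightarrow> real \<Rightarrow> complex" where
  "hurwitz_reg_aux 0 s a = (s - 1) * hurwitz_series s a"
| "hurwitz_reg_aux (Suc n) s a = complex_of_real a powr (1 - s) +
     (s - 1) * integral {0..1} (\<lambda>u. complex_of_real (1 - u) * hurwitz_reg_aux n (s + 1) (a + u))"

text \<open>Both properties run through one induction because holomorphy at the next level comes
  from differentiating under the integral, which rests on joint continuity at the present level.
  Evaluating level \<open>n\<close> at \<open>s + 1\<close> moves the half-plane one unit to the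
  left.\<close>

lemma hurwitz_reg_aux_regular:
  "continuous_on ({s. 1 - real n < Re s} \<times> {0<..}) (\<lambda>p. hurwitz_reg_aux n (fst p) (snd p)) \<and>
   (\<forall>a>0. (\<lambda>s. hurwitz_reg_aux n s a) holomorphic_on {s. 1 - real n < Re s})"
proof (induction n)
  case 0
  have "continuous_on ({s. 1 < Re s} \<times> {0<..}) (\<lambda>p. (fst p - 1) * hurwitz_series (fst p) (snd p))"
    by (intro continuous_intros continuous_on_hurwitz_series)
  moreover have "(\<lambda>s. (s - 1) * hurwitz_series s a) holomorphic_on {s. 1 < Re s}" if "a > 0" for a
    using that by (intro holomorphic_intros holomorphic_on_hurwitz_series)
  ultimately show ?case by simp
next
  case (Suc n)
  let ?W = "hurwitz_reg_aux n" and ?S = "{s. 1 - real (Suc n) < Re s}"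
  have cont: "continuous_on ({s. 1 - real n < Re s} \<times> {0<..}) (\<lambda>p. ?W (fst p) (snd p))"
    and hol: "\<And>a. a > 0 \<Longrightarrow> (\<lambda>s. ?W s a) holomorphic_on {s. 1 - real n < Re s}"
    using Suc by auto
  have "continuous_on (?S \<times> {0<..}) (\<lambda>p. hurwitz_reg_aux (Suc n) (fst p) (snd p))"
  proof -
    have "continuous_on ((?S \<times> {0<..}) \<times> cbox 0 1)
       ((\<lambda>p. ?W (fst p) (snd p)) \<circ> (\<lambda>q. (fst (fst q) + 1, snd (fst q) + snd q)))"
      by (intro continuous_on_compose continuous_on_subset[OF cont] continuous_intros) auto
    then have "continuous_on ((?S \<times> {0<..}) \<times> cbox 0 1)
       (\<lambda>(p, u). complex_of_real (1 - u) * ?W (fst p + 1) (snd p + u))"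
      unfolding o_def case_prod_unfold by (intro continuous_intros) auto
    from integral_continuous_on_param[OF this]
    have "continuous_on (?S \<times> {0<..})
      (\<lambda>p. integral {0..1} (\<lambda>u. complex_of_real (1 - u) * ?W (fst p + 1) (snd p + u)))"
      by simp
    moreover have "continuous_on (?S \<times> {0<..}) (\<lambda>p. complex_of_real (snd p) powr (1 - fst p))"
      by (intro continuous_on_powr_complex continuous_intros) auto
    ultimately show ?thesis
      unfolding hurwitz_reg_aux.simps
      by (intro continuous_on_add continuous_on_mult continuous_on_diff continuous_on_fst
          continuous_on_id continuous_on_const)
  qed
  moreover have "(\<lambda>s. hurwitz_reg_aux (Suc n) s a) holomorphic_on ?S" if a: "a > 0" for a
  proof -
    define f where "f s u = complex_of_real (1 - u) * ?W (s + 1) (a + u)" for s u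
    have "((\<lambda>s. integral {0..1} (f s)) has_field_derivative
        integral {0..1} (\<lambda>t. deriv (\<lambda>s. f s t) s)) (at s)" if s: "s \<in> ?S" for s
    \<comment> \<open>For \<open>t\<close> in \<open>{-a<..}\<close> the argument
      \<open>a + t\<close> remains positive.\<close>
    proof (rule integral_param_has_field_derivative[where S = ?S and A = "{-a<..}"])
      show "open ?S" "convex ?S" by (auto simp: open_halfspace_Re_gt convex_halfspace_Re_gt)
      have "continuous_on (?S \<times> {-a<..})
         ((\<lambda>p. ?W (fst p) (snd p)) \<circ> (\<lambda>q. (fst q + 1, a + snd q)))"
        by (intro continuous_on_compose continuous_on_subset[OF cont] continuous_intros) auto
      then show "continuous_on (?S \<times> {-a<..}) (\<lambda>p. f (fst p) (snd p))"
        unfolding o_def f_def by (intro continuous_intros) auto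
      fix t assume "t \<in> {-a<..}"
      then have "(\<lambda>s. ?W s (a + t)) \<circ> (\<lambda>s. s + 1) holomorphic_on ?S"
        by (intro holomorphic_on_compose holomorphic_on_subset[OF hol] holomorphic_intros) auto
      then show "(\<lambda>s. f s t) holomorphic_on ?S"
        unfolding o_def f_def by (intro holomorphic_intros)
    qed (use s a in auto)
    then have "(\<lambda>s. integral {0..1} (f s)) holomorphic_on ?S"
      by (subst holomorphic_on_open) (auto simp: open_halfspace_Re_gt)
    then show ?thesis
      unfolding hurwitz_reg_aux.simps f_def using a
      by (intro holomorphic_intros) auto
  qed
  ultimately show ?case by blast
qed

text \<open>Consistency of the levels needs no identity theorem: the base is
  \<open>hurwitz_series_regularized\<close>, and the step carries the induction hypothesis at
  \<open>s + 1\<close> under the integral.\<close>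

lemma hurwitz_reg_aux_Suc_eq:
  "1 - real n < Re s \<Longrightarrow> 0 < a \<Longrightarrow> hurwitz_reg_aux (Suc n) s a = hurwitz_reg_aux n s a"
proof (induction n arbitrary: s a)
  case 0
  then show ?case using hurwitz_series_regularized[of s a] by simp
next
  case (Suc n)
  have "hurwitz_reg_aux (Suc n) (s + 1) (a + u) = hurwitz_reg_aux n (s + 1) (a + u)"
    if "u \<in> {0..1}" for u
    using Suc.prems that by (intro Suc.IH) auto
  then have "integral {0..1} (\<lambda>u. complex_of_real (1 - u) * hurwitz_reg_aux (Suc n) (s + 1) (a + u)) =
      integral {0..1} (\<lambda>u. complex_of_real (1 - u) * hurwitz_reg_aux n (s + 1) (a + u))"
    by (intro integral_cong) (simp del: hurwitz_reg_aux.simps)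
  then show ?case
    by (simp only: hurwitz_reg_aux.simps(2)[of "Suc n"] hurwitz_reg_aux.simps(2)[of n])
qed

lemma hurwitz_reg_aux_eq:
  assumes "1 - real n < Re s" "0 < a" "n \<le> m"
  shows "hurwitz_reg_aux m s a = hurwitz_reg_aux n s a"
  using assms(3)
proof (induction m rule: dec_induct)
  case (step m)
  then have "1 - real m < Re s" using assms(1) by linarith
  then show ?case using step assms(2) hurwitz_reg_aux_Suc_eq by metis
qed simp

text \<open>The entire function (s - 1) zeta(s, a). The chosen level n satisfies
  \<open>1 - real n < Re s\<close>, so \<open>s\<close> lies in its half-plane.\<close>

definition hurwitz_reg :: "complex \<Rightarrow> real \<Rightarrow> complex" where
  "hurwitz_reg s a = hurwitz_reg_aux (nat \<lceil>2 - Re s\<rceil>) s a"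

lemma hurwitz_reg_eq_aux:
  assumes "1 - real n < Re s" "0 < a"
  shows "hurwitz_reg s a = hurwitz_reg_aux n s a"
proof -
  have "1 - real (nat \<lceil>2 - Re s\<rceil>) < Re s" by linarith
  then show ?thesis
    unfolding hurwitz_reg_def using hurwitz_reg_aux_eq assms by (metis nle_le)
qed

lemma hurwitz_reg_eq_series:
  assumes "1 < Re s" "0 < a"
  shows "hurwitz_reg s a = (s - 1) * hurwitz_series s a"
  using hurwitz_reg_eq_aux[of 0 s a] assms by simp

lemma Un_half_planes: "(\<Union>n. {s. 1 - real n < Re s}) = UNIV"
proof -
  have "\<exists>n. 1 - real n < Re s" for s
    using reals_Archimedean2[of "1 - Re s"] by (auto simp: algebra_simps)
  then show ?thesis by auto
qed

lemma continuous_on_hurwitz_reg: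
  "continuous_on (UNIV \<times> {0<..}) (\<lambda>p. hurwitz_reg (fst p) (snd p))"
proof -
  have "continuous_on ({s. 1 - real n < Re s} \<times> {0<..}) (\<lambda>p. hurwitz_reg (fst p) (snd p))" for n
    using hurwitz_reg_aux_regular[of n]
    by (subst continuous_on_cong[OF refl hurwitz_reg_eq_aux[of n]]) auto
  then have "continuous_on (\<Union>n. {s. 1 - real n < Re s} \<times> {0<..}) (\<lambda>p. hurwitz_reg (fst p) (snd p))"
    by (intro continuous_on_open_UN) (auto intro!: open_Times open_halfspace_Re_gt)
  moreover have "(\<Union>n. {s. 1 - real n < Re s} \<times> {0<..}) = UNIV \<times> {0::real<..}"
    using Un_half_planes by blast
  ultimately show ?thesis by simp
qed

lemma holomorphic_on_hurwitz_reg: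
  assumes "0 < a"
  shows "(\<lambda>s. hurwitz_reg s a) holomorphic_on A"
proof -
  have "(\<lambda>s. hurwitz_reg s a) holomorphic_on {s. 1 - real n < Re s}" for n
    using hurwitz_reg_aux_regular[of n] assms
    by (subst holomorphic_cong[OF refl hurwitz_reg_eq_aux[of n]]) auto
  then have "(\<lambda>s. hurwitz_reg s a) holomorphic_on (\<Union>n. {s. 1 - real n < Re s})"
    by (intro holomorphic_on_UN_open) (auto intro: open_halfspace_Re_gt)
  then show ?thesis
    unfolding Un_half_planes by (rule holomorphic_on_subset) auto
qed

lemma entire_eqI:
  assumes "f holomorphic_on UNIV" "g holomorphic_on UNIV" "\<And>s. c < Re s \<Longrightarrow> f s = g s"
  shows "f s = g s"
proof (rule analytic_continuation_open[of "{s. c < Re s}" UNIV f g s])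
  have "complex_of_real (c + 1) \<in> {s. c < Re s}" by simp
  then show "{s. c < Re s} \<noteq> {}" by blast
qed (use assms in \<open>auto simp: open_halfspace_Re_gt\<close>)

text \<open>Both sides of the first identity are entire in \<open>s\<close> and agree for
  \<open>1 < Re s\<close> by \<open>hurwitz_series_diff\<close>; the factor \<open>- s\<close> is
  absorbed, since \<open>hurwitz_reg (s + 1) t\<close> already contains \<open>s\<close>. The second
  part allows this identity to be differentiated in \<open>s\<close>.\<close>

lemma hurwitz_reg_diff:
  assumes "0 < a" "a \<le> b"
  shows "hurwitz_reg s b - hurwitz_reg s a = - (s - 1) * integral {a..b} (\<lambda>t. hurwitz_reg (s + 1) t)"
    and "((\<lambda>s. integral {a..b} (\<lambda>t. hurwitz_reg (s + 1) t)) has_field_derivative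
           integral {a..b} (\<lambda>t. deriv (\<lambda>s. hurwitz_reg s t) (s + 1))) (at s)"
proof -
  have shift: "deriv (\<lambda>s. hurwitz_reg (s + 1) t) s = deriv (\<lambda>s. hurwitz_reg s t) (s + 1)"
    if "t \<in> {0<..}" for s t
  proof (rule DERIV_imp_deriv)
    have "((\<lambda>s. hurwitz_reg s t) has_field_derivative deriv (\<lambda>s. hurwitz_reg s t) (s + 1)) (at (s + 1))"
      using that by (intro holomorphic_derivI[of _ UNIV] holomorphic_on_hurwitz_reg) auto
    then show "((\<lambda>s. hurwitz_reg (s + 1) t) has_field_derivative deriv (\<lambda>s. hurwitz_reg s t) (s + 1)) (at s)"
      by (simp only: DERIV_shift)
  qed
  have D: "((\<lambda>s. integral {a..b} (\<lambda>t. hurwitz_reg (s + 1) t)) has_field_derivative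
           integral {a..b} (\<lambda>t. deriv (\<lambda>s. hurwitz_reg (s + 1) t) s)) (at s)" for s
  proof (rule integral_param_has_field_derivative[where S = UNIV and A = "{0<..}"])
    have "continuous_on (UNIV \<times> {0<..})
         ((\<lambda>p. hurwitz_reg (fst p) (snd p)) \<circ> (\<lambda>q. (fst q + 1, snd q)))"
      by (intro continuous_on_compose continuous_on_subset[OF continuous_on_hurwitz_reg] continuous_intros) auto
    then show "continuous_on (UNIV \<times> {0<..}) (\<lambda>p. hurwitz_reg (fst p + 1) (snd p))"
      by (simp add: o_def)
    fix t :: real assume "t \<in> {0<..}"
    then have "(\<lambda>s. hurwitz_reg s t) \<circ> (\<lambda>s. s + 1) holomorphic_on UNIV"
      by (intro holomorphic_on_compose holomorphic_on_hurwitz_reg holomorphic_intros) auto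
    then show "(\<lambda>s. hurwitz_reg (s + 1) t) holomorphic_on UNIV"
      by (simp add: o_def)
  qed (use assms in auto)
  have "integral {a..b} (\<lambda>t. deriv (\<lambda>s. hurwitz_reg (s + 1) t) s) =
      integral {a..b} (\<lambda>t. deriv (\<lambda>s. hurwitz_reg s t) (s + 1))"
    using assms(1) by (intro integral_cong shift) auto
  with D[of s] show "((\<lambda>s. integral {a..b} (\<lambda>t. hurwitz_reg (s + 1) t)) has_field_derivative
           integral {a..b} (\<lambda>t. deriv (\<lambda>s. hurwitz_reg s t) (s + 1))) (at s)"
    by (simp only:)
  show "hurwitz_reg s b - hurwitz_reg s a = - (s - 1) * integral {a..b} (\<lambda>t. hurwitz_reg (s + 1) t)"
  proof (rule entire_eqI[where c = 1 and f = "\<lambda>s. hurwitz_reg s b - hurwitz_reg s a"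
        and g = "\<lambda>s. - (s - 1) * integral {a..b} (\<lambda>t. hurwitz_reg (s + 1) t)"])
    show "(\<lambda>s. hurwitz_reg s b - hurwitz_reg s a) holomorphic_on UNIV"
      using assms by (intro holomorphic_intros holomorphic_on_hurwitz_reg) auto
    have "(\<lambda>s. integral {a..b} (\<lambda>t. hurwitz_reg (s + 1) t)) holomorphic_on UNIV"
      using D by (auto simp: holomorphic_on_open)
    then show "(\<lambda>s. - (s - 1) * integral {a..b} (\<lambda>t. hurwitz_reg (s + 1) t)) holomorphic_on UNIV"
      by (intro holomorphic_intros)
    fix s :: complex assume s: "1 < Re s"
    have "integral {a..b} (\<lambda>t. hurwitz_reg (s + 1) t) = integral {a..b} (\<lambda>t. s * hurwitz_series (s + 1) t)"
      using s assms by (intro integral_cong) (auto simp: hurwitz_reg_eq_series)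
    also have "\<dots> = - (hurwitz_series s b - hurwitz_series s a)"
      using hurwitz_series_diff[OF s assms] by simp
    finally have "integral {a..b} (\<lambda>t. hurwitz_reg (s + 1) t) = - (hurwitz_series s b - hurwitz_series s a)" .
    then show "hurwitz_reg s b - hurwitz_reg s a = - (s - 1) * integral {a..b} (\<lambda>t. hurwitz_reg (s + 1) t)"
      using s assms by (simp add: hurwitz_reg_eq_series left_diff_distrib right_diff_distrib)
  qed
qed

section \<open>Derivatives in the second argument and duplication\<close>

text \<open>The bridge from integral identities to derivatives, used for the zeta side and the
  polylogarithms alike.\<close>

lemma has_vector_derivative_from_integral:
  fixes F :: "real \<Rightarrow> 'a::banach"
  assumes x: "c < x" "x < d" and cont: "continuous_on {c..d} f"
    and F: "\<And>u. c \<le> u \<Longrightarrow> u \<le> d \<Longrightarrow> F u - F c = integral {c..u} f"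
  shows "(F has_vector_derivative f x) (at x)"
proof -
  have D: "((\<lambda>u. F c + integral {c..u} f) has_vector_derivative 0 + f x) (at x within {c..d})"
    by (intro has_vector_derivative_add has_vector_derivative_const
        integral_has_vector_derivative[OF cont]) (use x in auto)
  have "(F has_vector_derivative 0 + f x) (at x within {c..d})"
  proof (rule has_vector_derivative_transform[OF _ _ D])
    show "F u = F c + integral {c..u} f" if "u \<in> {c..d}" for u
      using F[of u] that by (simp add: algebra_simps)
  qed (use x in auto)
  then show ?thesis using x by (simp add: at_within_Icc_at)
qed

definition hurwitz_reg_deriv :: "complex \<Rightarrow> real \<Rightarrow> complex" where
  "hurwitz_reg_deriv s a = deriv (\<lambda>s. hurwitz_reg s a) s"

lemma hurwitz_reg_has_field_derivative:
  assumes "0 < a"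
  shows "((\<lambda>s. hurwitz_reg s a) has_field_derivative hurwitz_reg_deriv s a) (at s)"
  unfolding hurwitz_reg_deriv_def
  by (rule holomorphic_derivI[OF holomorphic_on_hurwitz_reg[OF assms] open_UNIV UNIV_I])

lemma continuous_on_hurwitz_reg_arg: "A \<subseteq> {0<..} \<Longrightarrow> continuous_on A (hurwitz_reg s)"
  by (rule continuous_on_slice[where f = hurwitz_reg, OF continuous_on_hurwitz_reg]) auto

lemma continuous_on_hurwitz_reg_deriv_arg:
  assumes "A \<subseteq> {0<..}"
  shows "continuous_on A (hurwitz_reg_deriv s)"
proof (rule continuous_on_slice[where f = hurwitz_reg_deriv, OF _ UNIV_I assms])
  show "continuous_on (UNIV \<times> {0<..}) (\<lambda>p. hurwitz_reg_deriv (fst p) (snd p))"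
    unfolding hurwitz_reg_deriv_def
    by (rule continuous_on_deriv_param[where f = hurwitz_reg])
      (auto intro: continuous_on_hurwitz_reg holomorphic_on_hurwitz_reg)
qed

lemma hurwitz_reg_has_vector_derivative:
  assumes "0 < a"
  shows "(hurwitz_reg s has_vector_derivative - (s - 1) * hurwitz_reg (s + 1) a) (at a)"
proof (rule has_vector_derivative_from_integral[where c = "a / 2" and d = "a + 1"])
  show "continuous_on {a / 2..a + 1} (\<lambda>t. - (s - 1) * hurwitz_reg (s + 1) t)"
    using assms by (intro continuous_intros continuous_on_hurwitz_reg_arg) auto
  show "hurwitz_reg s u - hurwitz_reg s (a / 2) =
      integral {a / 2..u} (\<lambda>t. - (s - 1) * hurwitz_reg (s + 1) t)" if "a / 2 \<le> u" for u
    using hurwitz_reg_diff(1)[of "a / 2" u s] that assms by (simp only: integral_mult_right)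
qed (use assms in auto)

text \<open>Exchanging mixed partial derivatives is avoided: the integral identity of
  \<open>hurwitz_reg_diff\<close> is differentiated in \<open>s\<close>, and the product rule on
  \<open>- (s - 1) * I s\<close> yields the two terms.\<close>

lemma hurwitz_reg_deriv_has_vector_derivative:
  assumes "0 < a"
  shows "(hurwitz_reg_deriv s has_vector_derivative
           - hurwitz_reg (s + 1) a - (s - 1) * hurwitz_reg_deriv (s + 1) a) (at a)"
proof (rule has_vector_derivative_from_integral[where c = "a / 2" and d = "a + 1"])
  show "continuous_on {a / 2..a + 1} (\<lambda>t. - hurwitz_reg (s + 1) t - (s - 1) * hurwitz_reg_deriv (s + 1) t)"
    using assms by (intro continuous_intros continuous_on_hurwitz_reg_arg
        continuous_on_hurwitz_reg_deriv_arg) auto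
  fix u assume u: "a / 2 \<le> u"
  define I where "I s = integral {a / 2..u} (\<lambda>t. hurwitz_reg (s + 1) t)" for s
  define J where "J = integral {a / 2..u} (\<lambda>t. hurwitz_reg_deriv (s + 1) t)"
  have "(I has_field_derivative J) (at s)"
    unfolding I_def J_def hurwitz_reg_deriv_def
    by (rule hurwitz_reg_diff(2)) (use assms u in auto)
  then have "((\<lambda>s. - (s - 1) * I s) has_field_derivative - I s - (s - 1) * J) (at s)"
    by (auto intro!: derivative_eq_intros simp: algebra_simps)
  moreover have "((\<lambda>s. hurwitz_reg s u - hurwitz_reg s (a / 2)) has_field_derivative
      hurwitz_reg_deriv s u - hurwitz_reg_deriv s (a / 2)) (at s)"
    using assms u by (intro DERIV_diff hurwitz_reg_has_field_derivative) auto
  moreover have "(\<lambda>s. hurwitz_reg s u - hurwitz_reg s (a / 2)) = (\<lambda>s. - (s - 1) * I s)"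
    unfolding I_def using hurwitz_reg_diff(1)[of "a / 2" u] assms u by auto
  ultimately have "hurwitz_reg_deriv s u - hurwitz_reg_deriv s (a / 2) = - I s - (s - 1) * J"
    using DERIV_unique by metis
  also have "\<dots> = integral {a / 2..u} (\<lambda>t. - hurwitz_reg (s + 1) t - (s - 1) * hurwitz_reg_deriv (s + 1) t)"
  proof -
    have "{a / 2..u} \<subseteq> {0<..}" using assms by auto
    then have "hurwitz_reg (s + 1) integrable_on {a / 2..u}"
      "hurwitz_reg_deriv (s + 1) integrable_on {a / 2..u}"
      by (auto intro!: integrable_continuous_interval continuous_on_hurwitz_reg_arg
          continuous_on_hurwitz_reg_deriv_arg)
    then show ?thesis
      unfolding I_def J_def
      by (subst integral_diff) (auto intro!: integrable_neg integrable_on_mult_right)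
  qed
  finally show "hurwitz_reg_deriv s u - hurwitz_reg_deriv s (a / 2) =
     integral {a / 2..u} (\<lambda>t. - hurwitz_reg (s + 1) t - (s - 1) * hurwitz_reg_deriv (s + 1) t)" .
qed (use assms in auto)

section \<open>Duplication formulas\<close>

text \<open>Split the series at \<open>2 * a\<close> by parity: 2k + 2a = 2 (k + a) and 2k + 1 + 2a
  = 2 (k + a + 1/2).\<close>

lemma hurwitz_series_duplication:
  assumes "1 < Re s" "0 < a"
  shows "hurwitz_series s a + hurwitz_series s (a + 1/2) = 2 powr s * hurwitz_series s (2 * a)"
proof -
  let ?f = "\<lambda>k. 2 powr s * complex_of_real (real k + 2 * a) powr (- s)"
  have scale: "complex_of_real t powr (- s) = 2 powr s * complex_of_real (2 * t) powr (- s)"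
    if "0 < t" for t
  proof -
    have "complex_of_real (2 * t) powr (- s) = 2 powr (- s) * complex_of_real t powr (- s)"
      using that powr_times_real[of 2 "complex_of_real t" "- s"] by simp
    moreover have "2 powr s * 2 powr (- s) = (1 :: complex)"
      by (simp add: powr_minus)
    ultimately show ?thesis by simp
  qed
  have "?f sums (2 powr s * hurwitz_series s (2 * a))"
    using assms by (intro sums_mult hurwitz_series_sums) auto
  then have "(\<lambda>k. sum ?f {k * 2..<k * 2 + 2}) sums (2 powr s * hurwitz_series s (2 * a))"
    by (rule sums_group) simp
  also have "(\<lambda>k. sum ?f {k * 2..<k * 2 + 2}) =
     (\<lambda>k. complex_of_real (real k + a) powr (- s) + complex_of_real (real k + (a + 1/2)) powr (- s))"
  proof
    fix k
    have "sum ?f {k * 2..<k * 2 + 2} = ?f (2 * k) + ?f (2 * k + 1)"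
      by (simp add: eval_nat_numeral mult.commute del: of_real_add of_nat_Suc)
    also have "\<dots> = complex_of_real (real k + a) powr (- s) + complex_of_real (real k + (a + 1/2)) powr (- s)"
      using assms by (subst (1 2) scale) (auto simp: algebra_simps simp del: of_real_add of_real_mult)
    finally show "sum ?f {k * 2..<k * 2 + 2} =
      complex_of_real (real k + a) powr (- s) + complex_of_real (real k + (a + 1/2)) powr (- s)" .
  qed
  finally have "(\<lambda>k. complex_of_real (real k + a) powr (- s) + complex_of_real (real k + (a + 1/2)) powr (- s))
     sums (2 powr s * hurwitz_series s (2 * a))" .
  moreover have "(\<lambda>k. complex_of_real (real k + a) powr (- s) + complex_of_real (real k + (a + 1/2)) powr (- s))
     sums (hurwitz_series s a + hurwitz_series s (a + 1/2))"
    by (intro sums_add hurwitz_series_sums) (use assms in auto)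
  ultimately show ?thesis by (rule sums_unique2[symmetric])
qed

lemma hurwitz_reg_duplication:
  assumes "0 < a"
  shows "hurwitz_reg s a + hurwitz_reg s (a + 1/2) = 2 powr s * hurwitz_reg s (2 * a)"
proof (rule entire_eqI[where c = 1 and f = "\<lambda>s. hurwitz_reg s a + hurwitz_reg s (a + 1/2)"
      and g = "\<lambda>s. 2 powr s * hurwitz_reg s (2 * a)"])
  fix s :: complex assume "1 < Re s"
  then show "hurwitz_reg s a + hurwitz_reg s (a + 1/2) = 2 powr s * hurwitz_reg s (2 * a)"
    using assms hurwitz_series_duplication[of s a]
    by (simp add: hurwitz_reg_eq_series distrib_left[symmetric])
next
  show "(\<lambda>s. hurwitz_reg s a + hurwitz_reg s (a + 1/2)) holomorphic_on UNIV"
    using assms by (intro holomorphic_on_add holomorphic_on_hurwitz_reg) simp_all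
  show "(\<lambda>s. 2 powr s * hurwitz_reg s (2 * a)) holomorphic_on UNIV"
    using assms by (intro holomorphic_on_mult holomorphic_on_powr_right holomorphic_on_ident
        holomorphic_on_hurwitz_reg) simp_all
qed

text \<open>The \<open>ln 2\<close> term stems from differentiating \<open>2 powr s\<close>. It
  spoils the pure duplication relation and disappears only where the symmetrized
  \<open>hurwitz_reg\<close> vanishes.\<close>

lemma hurwitz_reg_deriv_duplication:
  assumes "0 < a"
  shows "hurwitz_reg_deriv s a + hurwitz_reg_deriv s (a + 1/2) =
           2 powr s * (of_real (ln 2) * hurwitz_reg s (2 * a) + hurwitz_reg_deriv s (2 * a))"
proof (rule DERIV_unique)
  show "((\<lambda>s. hurwitz_reg s a + hurwitz_reg s (a + 1/2)) has_field_derivative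
      hurwitz_reg_deriv s a + hurwitz_reg_deriv s (a + 1/2)) (at s)"
    using assms by (intro DERIV_add hurwitz_reg_has_field_derivative) auto
  have "((\<lambda>s. 2 powr s :: complex) has_field_derivative Ln 2 * 2 powr s) (at s)"
    by (rule has_field_derivative_powr_right) simp
  then have "((\<lambda>s. 2 powr s * hurwitz_reg s (2 * a)) has_field_derivative
     2 powr s * hurwitz_reg_deriv s (2 * a) + Ln 2 * 2 powr s * hurwitz_reg s (2 * a)) (at s)"
    using assms by (intro DERIV_mult' hurwitz_reg_has_field_derivative) auto
  moreover have "Ln 2 = of_real (ln 2)"
    using Ln_of_real[of 2] by simp
  ultimately show "((\<lambda>s. hurwitz_reg s a + hurwitz_reg s (a + 1/2)) has_field_derivative
     2 powr s * (of_real (ln 2) * hurwitz_reg s (2 * a) + hurwitz_reg_deriv s (2 * a))) (at s)"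
    using hurwitz_reg_duplication[OF assms] by (simp add: algebra_simps)
qed

section \<open>Link with the Hurwitz zeta function of the statement\<close>

text \<open>The quotient is a witness for the choice in \<open>hurwitz_zeta_def\<close>; the chosen
  function then equals it by the identity theorem, the punctured plane being connected.\<close>

lemma hurwitz_zeta_eq_reg:
  assumes "0 < a" "s \<noteq> 1"
  shows "hurwitz_zeta a s = hurwitz_reg s a / (s - 1)"
proof -
  let ?P = "\<lambda>f. f holomorphic_on (- {1}) \<and>
      (\<forall>s. 1 < Re s \<longrightarrow> f s = (\<Sum>k. complex_of_real (real k + a) powr (- s)))"
  let ?g = "\<lambda>s. hurwitz_reg s a / (s - 1)"
  have g: "?P ?g"
  proof (intro conjI allI impI)
    show "?g holomorphic_on - {1}"
      using assms by (intro holomorphic_intros holomorphic_on_hurwitz_reg) auto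
    fix s :: complex assume "1 < Re s"
    moreover from this have "s \<noteq> 1" by auto
    ultimately show "?g s = (\<Sum>k. complex_of_real (real k + a) powr (- s))"
      using assms by (simp add: hurwitz_reg_eq_series hurwitz_series_def)
  qed
  then have f: "?P (hurwitz_zeta a)"
    unfolding hurwitz_zeta_def by (rule someI[where P = ?P])
  show ?thesis
  proof (rule analytic_continuation_open[of "{s. 1 < Re s}" "- {1}" "hurwitz_zeta a" ?g s])
    have "complex_of_real 2 \<in> {s. 1 < Re s}" by simp
    then show "{s. 1 < Re s} \<noteq> {}" by blast
    show "connected (- {1::complex})"
      by (rule connected_punctured_universe) simp
    show "hurwitz_zeta a z = ?g z" if "z \<in> {s. 1 < Re s}" for z
      using f g that by simp
    show "{s. 1 < Re s} \<subseteq> - {1::complex}" by auto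
    show "hurwitz_zeta a holomorphic_on - {1}" "?g holomorphic_on - {1}"
      using f g by blast+
  qed (use assms in \<open>auto simp: open_halfspace_Re_gt\<close>)
qed

lemma hurwitz_zeta_deriv_eq_reg:
  assumes "0 < a" "s \<noteq> 1"
  shows "hurwitz_zeta_deriv s a =
           hurwitz_reg_deriv s a / (s - 1) - hurwitz_reg s a / (s - 1)\<^sup>2"
proof -
  have "hurwitz_zeta_deriv s a = deriv (\<lambda>s. hurwitz_reg s a / (s - 1)) s"
    unfolding hurwitz_zeta_deriv_def
  proof (rule deriv_cong_ev)
    have "\<forall>\<^sub>F z in nhds s. z \<in> - {1}"
      using assms by (intro eventually_nhds_in_open) auto
    then show "\<forall>\<^sub>F z in nhds s. hurwitz_zeta a z = hurwitz_reg z a / (z - 1)"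
      by eventually_elim (use assms in \<open>auto intro: hurwitz_zeta_eq_reg\<close>)
  qed simp
  also have "\<dots> = (hurwitz_reg_deriv s a * (s - 1) - hurwitz_reg s a * 1) / ((s - 1) * (s - 1))"
    using assms by (intro DERIV_imp_deriv DERIV_divide hurwitz_reg_has_field_derivative)
      (auto intro!: derivative_eq_intros)
  also have "\<dots> = hurwitz_reg_deriv s a / (s - 1) - hurwitz_reg s a / (s - 1)\<^sup>2"
    using assms by (simp add: diff_divide_distrib power2_eq_square)
  finally show ?thesis .
qed

section \<open>Rigidity under reflection and duplication\<close>

lemma symmetric_distribution_eq_zero:
  fixes h :: "real \<Rightarrow> complex"
  assumes h: "\<And>x. 0 < x \<Longrightarrow> x < 1 \<Longrightarrow> (h has_vector_derivative h' x) (at x)"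
    and h': "\<And>x. 0 < x \<Longrightarrow> x < 1 \<Longrightarrow> (h' has_vector_derivative 0) (at x)"
    and sym: "\<And>x. 0 < x \<Longrightarrow> x < 1 \<Longrightarrow> h (1 - x) = h x"
    and dup: "\<And>x. 0 < x \<Longrightarrow> x < 1/2 \<Longrightarrow> h x + h (x + 1/2) = q * h (2 * x)"
    and q: "q \<noteq> 2" and x: "0 < x" "x < 1"
  shows "h x = 0"
proof -
  obtain c where c: "h' y = c" if "y \<in> {0<..<1}" for y
    by (rule has_vector_derivative_zero_constant[of "{0<..<1}" h'])
      (use has_vector_derivative_at_within[OF h'] in auto)
  have "((\<lambda>y. h y - of_real y * c) has_vector_derivative 0) (at y within {0<..<1})" if "y \<in> {0<..<1}" for y
  proof -
    have "((\<lambda>y. h y - of_real y * c) has_vector_derivative h' y - of_real 1 * c) (at y)"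
      using that by (intro has_vector_derivative_diff h has_vector_derivative_mult_left
          has_vector_derivative_of_real DERIV_ident) auto
    then show ?thesis using c[OF that] has_vector_derivative_at_within by fastforce
  qed
  then obtain d where d: "h y - of_real y * c = d" if "y \<in> {0<..<1}" for y
    using has_vector_derivative_zero_constant[of "{0<..<1}" "\<lambda>y. h y - of_real y * c"] by auto
  \<comment> \<open>By now \<open>h\<close> is affine. The point 1/4 serves both relations: its
    reflection 3/4 is also its half-shift, and its double 1/2 is still inside the interval.\<close>
  have "h (1 - 1/4) = h (1/4)" by (rule sym) auto
  then have "c = 0" using d[of "1/4"] d[of "3/4"] by (auto simp: field_simps)
  then have hd: "h y = d" if "y \<in> {0<..<1}" for y using d[OF that] by simp
  have "h (1/4) + h (1/4 + 1/2) = q * h (2 * (1/4))" by (rule dup) auto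
  then have "d + d = q * d" by (simp add: hd)
  then have "(2 - q) * d = 0" by (simp add: algebra_simps)
  then have "d = 0" using q by auto
  then show ?thesis using hd x by simp
qed

section \<open>Polylogarithms on the unit circle\<close>

text \<open>Multiplying by \<open>1 - z\<close> replaces the coefficients 1/k by their consecutive
  differences, which are absolutely summable on the whole closed disc.\<close>

lemma abel_summation_log:
  fixes z :: complex
  shows "(1 - z) * (\<Sum>k<n. z ^ Suc k / of_nat (Suc k)) =
     z - z ^ Suc n / of_nat (Suc n) -
     (\<Sum>k<n. z ^ (k + 2) * of_real (inverse (real (Suc k)) - inverse (real (Suc (Suc k)))))"
proof (induction n)
  case (Suc n)
  show ?case
    unfolding sum.lessThan_Suc distrib_left Suc
    by (simp add: divide_inverse algebra_simps del: of_nat_Suc)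
qed simp

text \<open>The M-test majorants are the coefficients themselves, whose sum telescopes.\<close>

lemma uniform_limit_log_remainder:
  "uniform_limit (cball 0 1)
     (\<lambda>n z. \<Sum>k<n. z ^ (k + 2) * complex_of_real (inverse (real (Suc k)) - inverse (real (Suc (Suc k)))))
     (\<lambda>z. \<Sum>k. z ^ (k + 2) * complex_of_real (inverse (real (Suc k)) - inverse (real (Suc (Suc k)))))
     sequentially"
proof (rule Weierstrass_m_test)
  fix k :: nat and z :: complex assume "z \<in> cball 0 1"
  then have "cmod z ^ (k + 2) \<le> 1" by (intro power_le_one) auto
  moreover have nonneg: "0 \<le> inverse (real (Suc k)) - inverse (real (Suc (Suc k)))"
    by (simp add: field_simps)
  ultimately have "cmod z ^ (k + 2) * (inverse (real (Suc k)) - inverse (real (Suc (Suc k)))) \<le>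
      1 * (inverse (real (Suc k)) - inverse (real (Suc (Suc k))))"
    by (intro mult_right_mono)
  then show "cmod (z ^ (k + 2) * complex_of_real (inverse (real (Suc k)) - inverse (real (Suc (Suc k)))))
     \<le> inverse (real (Suc k)) - inverse (real (Suc (Suc k)))"
    using nonneg by (simp only: norm_mult norm_power norm_of_real abs_of_nonneg mult_1_left)
next
  show "summable (\<lambda>k. inverse (real (Suc k)) - inverse (real (Suc (Suc k))))"
    using telescope_sums'[OF LIMSEQ_inverse_real_of_nat] by (auto intro: sums_summable)
qed

text \<open>Dividing by \<open>1 - z\<close> gives Abel's limit theorem for the logarithmic series on the closed disc.\<close>

lemma log_remainder_eq:
  assumes "z \<in> cball 0 1 - {1}"
  shows "z - (\<Sum>k. z ^ (k + 2) * complex_of_real (inverse (real (Suc k)) - inverse (real (Suc (Suc k))))) =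
           (1 - z) * (- Ln (1 - z))"
proof -
  define S where "S z = (\<Sum>k. z ^ (k + 2) *
     complex_of_real (inverse (real (Suc k)) - inverse (real (Suc (Suc k)))))" for z
  have S: "(\<lambda>n. \<Sum>k<n. z ^ (k + 2) * complex_of_real (inverse (real (Suc k)) - inverse (real (Suc (Suc k)))))
     \<longlonglongrightarrow> S z" if "z \<in> cball 0 1" for z
    unfolding S_def by (rule tendsto_uniform_limitI[OF uniform_limit_log_remainder that])
  have contS: "continuous_on (cball 0 1) S"
    unfolding S_def
    by (rule uniform_limit_theorem[OF _ uniform_limit_log_remainder])
      (auto intro!: always_eventually continuous_intros)
  \<comment> \<open>Inside the disc the Taylor series of the logarithm converges and the boundary
    term of the Abel summation tends to 0.\<close>
  have eq: "z - S z = (1 - z) * (- Ln (1 - z))" if z: "z \<in> ball 0 1" for z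
  proof (rule LIMSEQ_unique)
    have "(\<lambda>n. - (z ^ n) / of_nat n) sums ln (1 - z)"
      using Ln_series'[of "- z"] z by simp
    from sums_minus[OF this] have "(\<lambda>n. z ^ n / of_nat n) sums (- ln (1 - z))" by simp
    from sums_split_initial_segment[OF this, of 1]
    have "(\<lambda>n. \<Sum>k<n. z ^ Suc k / of_nat (Suc k)) \<longlonglongrightarrow> - Ln (1 - z)"
      by (simp add: sums_def)
    then show "(\<lambda>n. (1 - z) * (\<Sum>k<n. z ^ Suc k / of_nat (Suc k))) \<longlonglongrightarrow> (1 - z) * (- Ln (1 - z))"
      by (intro tendsto_intros)
    have "(\<lambda>n. z ^ Suc n / of_nat (Suc n)) \<longlonglongrightarrow> 0"
    proof (rule tendsto_norm_zero_cancel, rule tendsto_sandwich[OF _ _ tendsto_const LIMSEQ_inverse_real_of_nat])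
      show "\<forall>\<^sub>F n in sequentially. norm (z ^ Suc n / of_nat (Suc n)) \<le> inverse (real (Suc n))"
        using z power_le_one[of "cmod z"]
        by (intro always_eventually allI)
          (simp add: norm_mult norm_inverse norm_power divide_inverse mult_left_le_one_le
            del: power_Suc of_nat_Suc)
    qed auto
    then have "(\<lambda>n. z - z ^ Suc n / of_nat (Suc n) -
       (\<Sum>k<n. z ^ (k + 2) * complex_of_real (inverse (real (Suc k)) - inverse (real (Suc (Suc k))))))
       \<longlonglongrightarrow> z - 0 - S z"
      using z by (intro tendsto_intros S) auto
    then show "(\<lambda>n. (1 - z) * (\<Sum>k<n. z ^ Suc k / of_nat (Suc k))) \<longlonglongrightarrow> z - S z"
      by (simp only: abel_summation_log diff_zero)
  qed
  \<comment> \<open>Radial approach to \<open>z\<close> from inside the disc. Both sides are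
    continuous there: the remainder series on the closed disc, and \<open>Ln\<close> at
    \<open>1 - z\<close>, which is off the branch cut as \<open>z \<noteq> 1\<close> and
    \<open>Re z \<le> 1\<close>.\<close>
  define r where "r n = complex_of_real (1 - inverse (real (Suc n))) * z" for n
  have r0: "r \<longlonglongrightarrow> complex_of_real (1 - 0) * z"
    unfolding r_def by (intro tendsto_intros LIMSEQ_inverse_real_of_nat)
  have rb: "r n \<in> ball 0 1" for n
  proof -
    have "cmod (r n) = \<bar>1 - inverse (real (Suc n))\<bar> * cmod z"
      unfolding r_def by (simp only: norm_mult norm_of_real)
    also have "\<dots> = (1 - inverse (real (Suc n))) * cmod z"
      by (simp add: field_simps)
    also have "\<dots> \<le> (1 - inverse (real (Suc n))) * 1"
      using assms by (intro mult_left_mono) (auto simp: field_simps)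
    also have "\<dots> < 1" by simp
    finally show ?thesis by simp
  qed
  have "(\<lambda>n. r n - S (r n)) \<longlonglongrightarrow> z - S z"
    using r0 assms rb by (intro tendsto_diff continuous_on_tendsto_compose[OF contS])
      (auto intro!: always_eventually less_imp_le)
  moreover have "(\<lambda>n. (1 - r n) * (- Ln (1 - r n))) \<longlonglongrightarrow> (1 - z) * (- Ln (1 - z))"
  proof (intro tendsto_intros)
    show "1 - z \<notin> \<real>\<^sub>\<le>\<^sub>0"
    proof
      assume "1 - z \<in> \<real>\<^sub>\<le>\<^sub>0"
      then have "1 \<le> Re z" "Im z = 0" by (auto simp: complex_nonpos_Reals_iff)
      moreover have "Re z \<le> 1" using complex_Re_le_cmod[of z] assms by auto
      ultimately show False using assms by (auto simp: complex_eq_iff)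
    qed
  qed (use r0 in simp_all)
  ultimately have "z - S z = (1 - z) * (- Ln (1 - z))"
    using eq[OF rb] LIMSEQ_unique by (simp only:)
  then show ?thesis by (simp only: S_def)
qed

text \<open>The polylogarithm of order \<open>j\<close> at the point exp(2 pi i t). Exponentials are
  preferred to cosines because differentiation lowers \<open>j\<close> by one at the cost of a
  constant factor.\<close>

definition circle_polylog :: "nat \<Rightarrow> real \<Rightarrow> complex" where
  "circle_polylog j t = (\<Sum>k. cis (2 * pi * t) ^ Suc k / of_nat (Suc k) ^ j)"

lemma cis_2pi_neq_1: "0 < t \<Longrightarrow> t < 1 \<Longrightarrow> cis (2 * pi * t) \<noteq> 1"
proof
  assume t: "0 < t" "t < 1" and "cis (2 * pi * t) = 1"
  then have "cos (2 * pi * t) = 1" by (simp add: complex_eq_iff)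
  then obtain n :: int where "2 * pi * t = of_int n * 2 * pi"
    by (auto simp: cos_one_2pi_int)
  then have "t = of_int n" by simp
  with t show False by auto
qed

text \<open>On a compact subinterval of (0, 1) the factor \<open>1 - cis (2 * pi * t)\<close> is
  bounded away from 0, so the Abel-summed identity may be divided by it without losing
  uniformity.\<close>

lemma uniform_limit_circle_polylog_1:
  assumes "0 < \<alpha>" "\<beta> < 1"
  shows "uniform_limit {\<alpha>..\<beta>} (\<lambda>n t. \<Sum>k<n. cis (2 * pi * t) ^ Suc k / of_nat (Suc k))
     (\<lambda>t. - Ln (1 - cis (2 * pi * t))) sequentially"
proof -
  let ?c = "\<lambda>k. complex_of_real (inverse (real (Suc k)) - inverse (real (Suc (Suc k))))"
  define S where "S z = (\<Sum>k. z ^ (k + 2) * ?c k)" for z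
  define e where "e t = cis (2 * pi * t)" for t
  have ne: "1 - e t \<noteq> 0" if "t \<in> {\<alpha>..\<beta>}" for t
    using cis_2pi_neq_1[of t] that assms by (auto simp: e_def)
  have norm_e: "cmod (e t) = 1" for t by (simp add: e_def)
  have conte: "continuous_on {\<alpha>..\<beta>} e"
    unfolding e_def by (intro continuous_intros)
  have contS: "continuous_on (cball 0 1) S"
    unfolding S_def
    by (rule uniform_limit_theorem[OF _ uniform_limit_log_remainder])
      (auto intro!: always_eventually continuous_intros)
  have "uniform_limit {\<alpha>..\<beta>} (\<lambda>n t. \<Sum>k<n. e t ^ (k + 2) * ?c k) (\<lambda>t. S (e t)) sequentially"
    unfolding S_def
    by (rule uniform_limit_compose'[OF uniform_limit_log_remainder]) (auto simp: norm_e)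
  moreover have "uniform_limit {\<alpha>..\<beta>} (\<lambda>n t. e t ^ Suc n / of_nat (Suc n)) (\<lambda>_. 0) sequentially"
  proof (rule uniform_limit_null_comparison)
    show "\<forall>\<^sub>F n in sequentially. \<forall>t\<in>{\<alpha>..\<beta>}. cmod (e t ^ Suc n / of_nat (Suc n)) \<le> inverse (real (Suc n))"
      by (simp add: norm_mult norm_inverse norm_power norm_e divide_inverse del: of_nat_Suc power_Suc)
    show "uniform_limit {\<alpha>..\<beta>} (\<lambda>n t. inverse (real (Suc n))) (\<lambda>_. 0) sequentially"
      using LIMSEQ_inverse_real_of_nat unfolding uniform_limit_iff tendsto_iff by auto
  qed
  ultimately have "uniform_limit {\<alpha>..\<beta>}
     (\<lambda>n t. e t - e t ^ Suc n / of_nat (Suc n) - (\<Sum>k<n. e t ^ (k + 2) * ?c k))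
     (\<lambda>t. e t - 0 - S (e t)) sequentially"
    by (intro uniform_limit_intros uniform_limit_const)
  moreover have "bounded ((\<lambda>t. inverse (1 - e t)) ` {\<alpha>..\<beta>})"
    using ne by (intro compact_imp_bounded compact_continuous_image continuous_intros conte) auto
  moreover have "bounded ((\<lambda>t. e t - 0 - S (e t)) ` {\<alpha>..\<beta>})"
    by (intro compact_imp_bounded compact_continuous_image continuous_intros conte
        continuous_on_compose2[OF contS]) (auto simp: norm_e)
  ultimately have "uniform_limit {\<alpha>..\<beta>}
     (\<lambda>n t. inverse (1 - e t) * (e t - e t ^ Suc n / of_nat (Suc n) - (\<Sum>k<n. e t ^ (k + 2) * ?c k)))
     (\<lambda>t. inverse (1 - e t) * (e t - 0 - S (e t))) sequentially"
    by (intro uniform_lim_mult uniform_limit_const)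
  moreover have "inverse (1 - e t) * (e t - e t ^ Suc n / of_nat (Suc n) - (\<Sum>k<n. e t ^ (k + 2) * ?c k)) =
      (\<Sum>k<n. e t ^ Suc k / of_nat (Suc k))" if "t \<in> {\<alpha>..\<beta>}" for n t
    unfolding abel_summation_log[symmetric] using ne[OF that] by simp
  moreover have "inverse (1 - e t) * (e t - 0 - S (e t)) = - Ln (1 - e t)" if "t \<in> {\<alpha>..\<beta>}" for t
  proof -
    have "e t - S (e t) = (1 - e t) * (- Ln (1 - e t))"
      unfolding S_def using ne[OF that] by (intro log_remainder_eq) (auto simp: norm_e)
    then show ?thesis using ne[OF that] by simp
  qed
  ultimately show ?thesis
    unfolding e_def[symmetric]
    by (subst (asm) uniform_limit_cong'[where g = "\<lambda>n t. \<Sum>k<n. e t ^ Suc k / of_nat (Suc k)"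
          and i = "\<lambda>t. - Ln (1 - e t)"]) auto
qed

lemma circle_polylog_1:
  assumes "0 < t" "t < 1"
  shows "circle_polylog 1 t = - Ln (1 - cis (2 * pi * t))"
  using tendsto_uniform_limitI[OF uniform_limit_circle_polylog_1[of t t], of t] assms
  by (simp add: circle_polylog_def sums_def sums_unique[symmetric] flip: sums_def)

text \<open>Absolute convergence settles \<open>j \<ge> 2\<close>; only \<open>j = 1\<close> relies
  on Abel summation and on staying away from the endpoints.\<close>

lemma uniform_limit_circle_polylog:
  assumes "0 < \<alpha>" "\<beta> < 1" "1 \<le> j"
  shows "uniform_limit {\<alpha>..\<beta>} (\<lambda>n t. \<Sum>k<n. cis (2 * pi * t) ^ Suc k / of_nat (Suc k) ^ j)
     (circle_polylog j) sequentially"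
proof (cases "j = 1")
  case True
  show ?thesis
    unfolding True power_one_right
    using uniform_limit_circle_polylog_1[OF assms(1,2)] circle_polylog_1 assms
    by (subst uniform_limit_cong'[where g = "\<lambda>n t. \<Sum>k<n. cis (2 * pi * t) ^ Suc k / of_nat (Suc k)"
          and i = "\<lambda>t. - Ln (1 - cis (2 * pi * t))"]) auto
next
  case False
  show ?thesis
    unfolding circle_polylog_def
  proof (rule Weierstrass_m_test)
    show "summable (\<lambda>k. inverse (real (Suc k) ^ j))"
      using False assms inverse_power_summable[of j, where 'a = real]
      by (subst summable_Suc_iff) auto
  qed (simp add: norm_mult norm_inverse norm_power divide_inverse del: of_nat_Suc power_Suc)
qed

lemma circle_polylog_sums:
  assumes "0 < t" "t < 1" "1 \<le> j"
  shows "(\<lambda>k. cis (2 * pi * t) ^ Suc k / of_nat (Suc k) ^ j) sums circle_polylog j t"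
  using tendsto_uniform_limitI[OF uniform_limit_circle_polylog[of t t j], of t] assms
  by (simp add: sums_def)

lemma circle_polylog_has_vector_derivative:
  assumes t: "0 < t" "t < 1" and j: "1 \<le> j"
  shows "(circle_polylog (Suc j) has_vector_derivative 2 * of_real pi * \<i> * circle_polylog j t) (at t)"
\<comment> \<open>Midpoints between \<open>t\<close> and the ends of (0, 1): a compact neighbourhood
  of \<open>t\<close> on which termwise integration is justified.\<close>
proof (rule has_vector_derivative_from_integral[where c = "t / 2" and d = "(t + 1) / 2"])
  let ?f = "\<lambda>j k t. cis (2 * pi * t) ^ Suc k / of_nat (Suc k) ^ j"
  have contf: "continuous_on A (?f j k)" for A k
    by (intro continuous_intros) (auto simp del: of_nat_Suc)
  have "continuous_on {t / 2..(t + 1) / 2} (circle_polylog j)"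
    by (rule uniform_limit_theorem[OF _ uniform_limit_circle_polylog])
      (use t j contf in \<open>auto intro!: always_eventually continuous_on_sum\<close>)
  then show cont: "continuous_on {t / 2..(t + 1) / 2} (\<lambda>t. 2 * of_real pi * \<i> * circle_polylog j t)"
    by (intro continuous_intros)
  fix u assume u: "t / 2 \<le> u" "u \<le> (t + 1) / 2"
  have D: "(?f (Suc j) k has_vector_derivative 2 * of_real pi * \<i> * ?f j k x) (at x within A)" for k x A
  proof -
    have "((\<lambda>z. exp (of_nat (Suc k) * (2 * of_real pi * \<i>) * z) / of_nat (Suc k) ^ Suc j) has_field_derivative
       exp (of_nat (Suc k) * (2 * of_real pi * \<i>) * of_real x) * (of_nat (Suc k) * (2 * of_real pi * \<i>)) / of_nat (Suc k) ^ Suc j)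
       (at (of_real x))"
      by (auto intro!: derivative_eq_intros simp del: of_nat_Suc power_Suc)
    from has_vector_derivative_real_field[OF this, of A]
    have "((\<lambda>x. exp (of_nat (Suc k) * (2 * of_real pi * \<i>) * of_real x) / of_nat (Suc k) ^ Suc j) has_vector_derivative
       exp (of_nat (Suc k) * (2 * of_real pi * \<i>) * of_real x) * (of_nat (Suc k) * (2 * of_real pi * \<i>)) / of_nat (Suc k) ^ Suc j)
       (at x within A)" .
    moreover have "exp (of_nat (Suc k) * (2 * of_real pi * \<i>) * complex_of_real x) = cis (2 * pi * x) ^ Suc k" for x
      by (simp add: cis_conv_exp exp_of_nat_mult[symmetric] mult_ac del: of_nat_Suc power_Suc)
    moreover have "y * (of_nat (Suc k) * c) / of_nat (Suc k) ^ Suc j = c * (y / of_nat (Suc k) ^ j)" for y c :: complex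
      by (simp add: field_simps del: of_nat_Suc)
    ultimately show ?thesis by (simp only:)
  qed
  have "integral {t / 2..u} (\<lambda>x. 2 * of_real pi * \<i> * ?f j k x) = ?f (Suc j) k u - ?f (Suc j) k (t / 2)" for k
    by (rule integral_unique, rule fundamental_theorem_of_calculus) (use u D in auto)
  moreover have "(\<lambda>k. integral {t / 2..u} (?f j k)) sums integral {t / 2..u} (circle_polylog j)"
    by (rule sums_integral_uniform_limit[OF uniform_limit_circle_polylog contf])
      (use t j u in auto)
  from sums_mult[OF this, of "2 * of_real pi * \<i>"]
  have "(\<lambda>k. integral {t / 2..u} (\<lambda>x. 2 * of_real pi * \<i> * ?f j k x)) sums
      integral {t / 2..u} (\<lambda>x. 2 * of_real pi * \<i> * circle_polylog j x)"
    by (simp only: integral_mult_right)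
  moreover have "(\<lambda>k. ?f (Suc j) k u - ?f (Suc j) k (t / 2)) sums
      (circle_polylog (Suc j) u - circle_polylog (Suc j) (t / 2))"
    using t u by (intro sums_diff circle_polylog_sums) auto
  ultimately show "circle_polylog (Suc j) u - circle_polylog (Suc j) (t / 2) =
      integral {t / 2..u} (\<lambda>x. 2 * of_real pi * \<i> * circle_polylog j x)"
    using sums_unique2 by (simp only:)
qed (use t in auto)

text \<open>A half-period shift changes the sign of the exponential, so odd powers cancel and even
  powers double. As the exponent is \<open>Suc k\<close>, it is the terms of even index that
  cancel.\<close>

lemma circle_polylog_duplication:
  assumes t: "0 < t" "t < 1/2" and j: "1 \<le> j"
  shows "circle_polylog j t + circle_polylog j (t + 1/2) = 2 / 2 ^ j * circle_polylog j (2 * t)"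
proof -
  let ?f = "\<lambda>t k. cis (2 * pi * t) ^ Suc k / of_nat (Suc k) ^ j"
  define e where "e = cis (2 * pi * t)"
  have half: "cis (2 * pi * (t + 1/2)) = - e"
    by (simp add: e_def complex_eq_iff distrib_left)
  have double: "cis (2 * pi * (2 * t)) = e ^ 2"
    by (simp add: e_def Complex.DeMoivre mult_ac)
  have "(\<lambda>k. ?f t k + ?f (t + 1/2) k) sums (circle_polylog j t + circle_polylog j (t + 1/2))"
    using t j by (intro sums_add circle_polylog_sums) auto
  then have "(\<lambda>k. sum (\<lambda>k. ?f t k + ?f (t + 1/2) k) {k * 2..<k * 2 + 2}) sums
      (circle_polylog j t + circle_polylog j (t + 1/2))"
    by (rule sums_group) simp
  also have "(\<lambda>k. sum (\<lambda>k. ?f t k + ?f (t + 1/2) k) {k * 2..<k * 2 + 2}) = (\<lambda>k. 2 / 2 ^ j * ?f (2 * t) k)"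
  proof
    fix k
    let ?g = "\<lambda>k. ?f t k + ?f (t + 1/2) k"
    have "sum ?g {k * 2..<k * 2 + 2} = ?g (2 * k) + ?g (2 * k + 1)"
      by (simp add: eval_nat_numeral mult.commute del: of_nat_Suc power_Suc)
    also have "?g (2 * k) = 0"
      unfolding half e_def[symmetric] by simp
    also have "?g (2 * k + 1) = 2 * (e\<^sup>2) ^ Suc k / of_nat (2 * Suc k) ^ j"
      unfolding half e_def[symmetric]
      by (simp add: power_mult power2_eq_square power_mult_distrib[symmetric] mult_ac del: of_nat_Suc)
    also have "0 + \<dots> = 2 / 2 ^ j * ?f (2 * t) k"
      unfolding double of_nat_mult by (simp add: power_mult_distrib del: of_nat_Suc power_Suc)
    finally show "sum ?g {k * 2..<k * 2 + 2} = 2 / 2 ^ j * ?f (2 * t) k" .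
  qed
  finally have "(\<lambda>k. 2 / 2 ^ j * ?f (2 * t) k) sums (circle_polylog j t + circle_polylog j (t + 1/2))" .
  moreover have "(\<lambda>k. 2 / 2 ^ j * ?f (2 * t) k) sums (2 / 2 ^ j * circle_polylog j (2 * t))"
    using t j by (intro sums_mult circle_polylog_sums) auto
  ultimately show ?thesis by (rule sums_unique2)
qed

section \<open>Reflection-symmetric sums\<close>

lemma has_vector_derivative_reflect:
  assumes "(f has_vector_derivative f') (at (1 - a))"
  shows "((\<lambda>t. f (1 - t)) has_vector_derivative - f') (at (a :: real))"
proof -
  have "((\<lambda>t. 1 - t) has_vector_derivative - 1) (at a)"
    by (auto intro!: derivative_eq_intros simp flip: has_real_derivative_iff_has_vector_derivative)
  from vector_diff_chain_at[OF this assms] show ?thesis by (simp add: o_def)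
qed

definition hurwitz_reg_sym :: "complex \<Rightarrow> real \<Rightarrow> complex" where
  "hurwitz_reg_sym s a = hurwitz_reg s a + hurwitz_reg s (1 - a)"

definition hurwitz_reg_deriv_sym :: "complex \<Rightarrow> real \<Rightarrow> complex" where
  "hurwitz_reg_deriv_sym s a = hurwitz_reg_deriv s a + hurwitz_reg_deriv s (1 - a)"

text \<open>The first derivative is antisymmetric under reflection, the second symmetric again, so
  the recursion closes with the shift by 2.\<close>

lemma hurwitz_reg_sym_derivs:
  assumes "0 < a" "a < 1"
  shows "(hurwitz_reg_sym s has_vector_derivative
      - (s - 1) * (hurwitz_reg (s + 1) a - hurwitz_reg (s + 1) (1 - a))) (at a)" (is ?th1)
    and "((\<lambda>a. - (s - 1) * (hurwitz_reg (s + 1) a - hurwitz_reg (s + 1) (1 - a))) has_vector_derivative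
      (s - 1) * s * hurwitz_reg_sym (s + 2) a) (at a)" (is ?th2)
proof -
  have D: "(hurwitz_reg s has_vector_derivative - (s - 1) * hurwitz_reg (s + 1) a) (at a)"
    "((\<lambda>a. hurwitz_reg s (1 - a)) has_vector_derivative - (- (s - 1) * hurwitz_reg (s + 1) (1 - a))) (at a)" for s
    using assms by (intro hurwitz_reg_has_vector_derivative has_vector_derivative_reflect; simp)+
  have "(hurwitz_reg_sym s has_vector_derivative
      - (s - 1) * hurwitz_reg (s + 1) a + - (- (s - 1) * hurwitz_reg (s + 1) (1 - a))) (at a)"
    unfolding hurwitz_reg_sym_def[abs_def] by (rule has_vector_derivative_add[OF D])
  then show ?th1 by (simp add: algebra_simps)
  have "((\<lambda>a. - (s - 1) * (hurwitz_reg (s + 1) a - hurwitz_reg (s + 1) (1 - a))) has_vector_derivative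
      - (s - 1) * (- (s + 1 - 1) * hurwitz_reg (s + 1 + 1) a -
        - (- (s + 1 - 1) * hurwitz_reg (s + 1 + 1) (1 - a)))) (at a)"
    by (rule has_vector_derivative_mult_right[OF has_vector_derivative_diff[OF D]])
  moreover have "s + 1 + 1 = s + 2" by simp
  ultimately show ?th2
    by (simp only: hurwitz_reg_sym_def) (simp add: algebra_simps)
qed

text \<open>The s-derivative of the preceding recursion: \<open>2 * s - 1\<close> is the derivative
  of \<open>(s - 1) * s\<close>.\<close>

lemma hurwitz_reg_deriv_sym_derivs:
  assumes "0 < a" "a < 1"
  shows "(hurwitz_reg_deriv_sym s has_vector_derivative
      - (hurwitz_reg (s + 1) a - hurwitz_reg (s + 1) (1 - a))
      - (s - 1) * (hurwitz_reg_deriv (s + 1) a - hurwitz_reg_deriv (s + 1) (1 - a))) (at a)" (is ?th1)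
    and "((\<lambda>a. - (hurwitz_reg (s + 1) a - hurwitz_reg (s + 1) (1 - a))
      - (s - 1) * (hurwitz_reg_deriv (s + 1) a - hurwitz_reg_deriv (s + 1) (1 - a))) has_vector_derivative
      (2 * s - 1) * hurwitz_reg_sym (s + 2) a + (s - 1) * s * hurwitz_reg_deriv_sym (s + 2) a) (at a)" (is ?th2)
proof -
  have W: "(hurwitz_reg s has_vector_derivative - (s - 1) * hurwitz_reg (s + 1) a) (at a)"
    "((\<lambda>a. hurwitz_reg s (1 - a)) has_vector_derivative - (- (s - 1) * hurwitz_reg (s + 1) (1 - a))) (at a)" for s
    using assms by (intro hurwitz_reg_has_vector_derivative has_vector_derivative_reflect; simp)+
  have V: "(hurwitz_reg_deriv s has_vector_derivative
      - hurwitz_reg (s + 1) a - (s - 1) * hurwitz_reg_deriv (s + 1) a) (at a)"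
    "((\<lambda>a. hurwitz_reg_deriv s (1 - a)) has_vector_derivative
      - (- hurwitz_reg (s + 1) (1 - a) - (s - 1) * hurwitz_reg_deriv (s + 1) (1 - a))) (at a)" for s
    using assms by (intro hurwitz_reg_deriv_has_vector_derivative has_vector_derivative_reflect; simp)+
  have "(hurwitz_reg_deriv_sym s has_vector_derivative
      (- hurwitz_reg (s + 1) a - (s - 1) * hurwitz_reg_deriv (s + 1) a) +
      - (- hurwitz_reg (s + 1) (1 - a) - (s - 1) * hurwitz_reg_deriv (s + 1) (1 - a))) (at a)"
    unfolding hurwitz_reg_deriv_sym_def[abs_def] by (rule has_vector_derivative_add[OF V])
  then show ?th1 by (simp add: algebra_simps)
  have "((\<lambda>a. - (hurwitz_reg (s + 1) a - hurwitz_reg (s + 1) (1 - a))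
      - (s - 1) * (hurwitz_reg_deriv (s + 1) a - hurwitz_reg_deriv (s + 1) (1 - a))) has_vector_derivative
      - (- (s + 1 - 1) * hurwitz_reg (s + 1 + 1) a - - (- (s + 1 - 1) * hurwitz_reg (s + 1 + 1) (1 - a)))
      - (s - 1) * ((- hurwitz_reg (s + 1 + 1) a - (s + 1 - 1) * hurwitz_reg_deriv (s + 1 + 1) a) -
        - (- hurwitz_reg (s + 1 + 1) (1 - a) - (s + 1 - 1) * hurwitz_reg_deriv (s + 1 + 1) (1 - a)))) (at a)"
    by (rule has_vector_derivative_diff[OF has_vector_derivative_minus[OF has_vector_derivative_diff[OF W]]
          has_vector_derivative_mult_right[OF has_vector_derivative_diff[OF V]]])
  moreover have "s + 1 + 1 = s + 2" by simp
  ultimately show ?th2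
    by (simp only: hurwitz_reg_sym_def hurwitz_reg_deriv_sym_def) (simp add: algebra_simps)
qed

text \<open>Add the relations at \<open>a\<close> and at \<open>1/2 - a\<close>; the half-shift of
  the latter is \<open>1 - a\<close>, so the four values pair up under reflection.\<close>

lemma symmetrize_duplication:
  fixes f F :: "real \<Rightarrow> complex"
  assumes "\<And>a. 0 < a \<Longrightarrow> a < 1/2 \<Longrightarrow> f a + f (a + 1/2) = F (2 * a)"
    and "0 < a" "a < 1/2"
  shows "(f a + f (1 - a)) + (f (a + 1/2) + f (1 - (a + 1/2))) = F (2 * a) + F (1 - 2 * a)"
proof -
  have eq: "1/2 - a + 1/2 = 1 - a" "2 * (1/2 - a) = 1 - 2 * a" "1 - (a + 1/2) = 1/2 - a" by auto
  have "f (1/2 - a) + f (1 - a) = F (1 - 2 * a)"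
    using assms(1)[of "1/2 - a"] assms(2,3) unfolding eq by simp
  moreover have "f a + f (a + 1/2) = F (2 * a)"
    using assms by simp
  moreover have "(f a + f (1 - a)) + (f (a + 1/2) + f (1/2 - a)) =
      (f a + f (a + 1/2)) + (f (1/2 - a) + f (1 - a))"
    by simp
  ultimately show ?thesis unfolding eq by simp
qed

lemma hurwitz_reg_sym_duplication:
  assumes "0 < a" "a < 1/2"
  shows "hurwitz_reg_sym s a + hurwitz_reg_sym s (a + 1/2) = 2 powr s * hurwitz_reg_sym s (2 * a)"
    and "hurwitz_reg_deriv_sym s a + hurwitz_reg_deriv_sym s (a + 1/2) =
      2 powr s * (of_real (ln 2) * hurwitz_reg_sym s (2 * a) + hurwitz_reg_deriv_sym s (2 * a))"
proof -
  have "hurwitz_reg_sym s a + hurwitz_reg_sym s (a + 1/2) =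
      2 powr s * hurwitz_reg s (2 * a) + 2 powr s * hurwitz_reg s (1 - 2 * a)"
    unfolding hurwitz_reg_sym_def
    by (rule symmetrize_duplication[where F = "\<lambda>x. 2 powr s * hurwitz_reg s x",
          OF hurwitz_reg_duplication assms])
  then show "hurwitz_reg_sym s a + hurwitz_reg_sym s (a + 1/2) = 2 powr s * hurwitz_reg_sym s (2 * a)"
    unfolding hurwitz_reg_sym_def by (simp only: distrib_left)
  define F where "F x = 2 powr s * (of_real (ln 2) * hurwitz_reg s x + hurwitz_reg_deriv s x)" for x
  have "hurwitz_reg_deriv_sym s a + hurwitz_reg_deriv_sym s (a + 1/2) = F (2 * a) + F (1 - 2 * a)"
    unfolding hurwitz_reg_deriv_sym_def
    by (rule symmetrize_duplication[where F = F, OF _ assms])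
      (unfold F_def, rule hurwitz_reg_deriv_duplication)
  then show "hurwitz_reg_deriv_sym s a + hurwitz_reg_deriv_sym s (a + 1/2) =
      2 powr s * (of_real (ln 2) * hurwitz_reg_sym s (2 * a) + hurwitz_reg_deriv_sym s (2 * a))"
    unfolding hurwitz_reg_sym_def hurwitz_reg_deriv_sym_def F_def by (simp add: distrib_left)
qed

lemma two_powr_minus_even: "(2 :: complex) powr (- of_nat (2 * k)) = 1 / 2 ^ (2 * k)"
  by (simp only: powr_minus powr_complexpow[OF zero_neq_numeral[symmetric]] inverse_eq_divide)

text \<open>Provides the condition \<open>q \<noteq> 2\<close> of the rigidity lemma.\<close>

lemma inverse_two_power_neq_two: "1 / 2 ^ n \<noteq> (2 :: complex)"
proof
  assume "1 / 2 ^ n = (2 :: complex)"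
  then have "2 ^ Suc n = (1 :: complex)" by (simp add: field_simps)
  then have "of_nat (2 ^ Suc n) = (of_nat 1 :: complex)" by simp
  then show False by (subst (asm) of_nat_eq_iff) simp
qed

section \<open>Vanishing at the nonpositive even integers\<close>

text \<open>Classically, zeta(-2k, a) is a multiple of the Bernoulli polynomial of odd degree 2k +
  1, which is antisymmetric under reflection. Here rigidity replaces Bernoulli polynomials.\<close>

lemma hurwitz_reg_sym_minus_even:
  "0 < a \<Longrightarrow> a < 1 \<Longrightarrow> hurwitz_reg_sym (- of_nat (2 * k)) a = 0"
proof (induction k arbitrary: a)
  case 0
  show ?case
  proof (rule symmetric_distribution_eq_zero[where q = "1 / 2 ^ (2 * 0)"])
    show "hurwitz_reg_sym (- of_nat (2 * 0)) x + hurwitz_reg_sym (- of_nat (2 * 0)) (x + 1/2) =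
        1 / 2 ^ (2 * 0) * hurwitz_reg_sym (- of_nat (2 * 0)) (2 * x)" if "0 < x" "x < 1/2" for x
      unfolding two_powr_minus_even[symmetric] using that by (rule hurwitz_reg_sym_duplication)
    show "(hurwitz_reg_sym (- of_nat (2 * 0)) has_vector_derivative
       - (- of_nat (2 * 0) - 1) * (hurwitz_reg (- of_nat (2 * 0) + 1) x - hurwitz_reg (- of_nat (2 * 0) + 1) (1 - x))) (at x)"
      if "0 < x" "x < 1" for x
      using that by (rule hurwitz_reg_sym_derivs)
    show "((\<lambda>x. - (- of_nat (2 * 0) - 1) * (hurwitz_reg (- of_nat (2 * 0) + 1) x -
        hurwitz_reg (- of_nat (2 * 0) + 1) (1 - x))) has_vector_derivative 0) (at x)"
      if "0 < x" "x < 1" for x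
      \<comment> \<open>At s = 0 the factor \<open>(s - 1) * s\<close> is 0, which starts the
        induction without knowledge of the value at 2.\<close>
      using hurwitz_reg_sym_derivs(2)[OF that, of "- of_nat (2 * 0)"] by simp
  qed (use 0 inverse_two_power_neq_two in \<open>auto simp: hurwitz_reg_sym_def\<close>)
next
  case (Suc k)
  define s :: complex where "s = - of_nat (2 * Suc k)"
  have s2: "s + 2 = - of_nat (2 * k)" by (simp add: s_def)
  have "hurwitz_reg_sym s a = 0"
  proof (rule symmetric_distribution_eq_zero[where q = "1 / 2 ^ (2 * Suc k)"])
    show "hurwitz_reg_sym s x + hurwitz_reg_sym s (x + 1/2) =
        1 / 2 ^ (2 * Suc k) * hurwitz_reg_sym s (2 * x)" if "0 < x" "x < 1/2" for x
      using hurwitz_reg_sym_duplication(1)[OF that, of s] two_powr_minus_even[of "Suc k"]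
      by (simp only: s_def)
    show "(hurwitz_reg_sym s has_vector_derivative
       - (s - 1) * (hurwitz_reg (s + 1) x - hurwitz_reg (s + 1) (1 - x))) (at x)"
      if "0 < x" "x < 1" for x
      using that by (rule hurwitz_reg_sym_derivs)
    show "((\<lambda>x. - (s - 1) * (hurwitz_reg (s + 1) x - hurwitz_reg (s + 1) (1 - x))) has_vector_derivative 0) (at x)"
      if "0 < x" "x < 1" for x
      using hurwitz_reg_sym_derivs(2)[OF that, of s] Suc.IH[OF that] by (simp only: s2 mult_zero_right)
  qed (use Suc.prems inverse_two_power_neq_two[of "2 * Suc k"] in \<open>auto simp: hurwitz_reg_sym_def\<close>)
  then show ?case by (simp only: s_def)
qed

section \<open>Cosine series and the case of exponent 1\<close>

definition circle_polylog_sym :: "nat \<Rightarrow> real \<Rightarrow> complex" where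
  "circle_polylog_sym j t = circle_polylog j t + circle_polylog j (1 - t)"

text \<open>Replacing \<open>t\<close> by \<open>1 - t\<close> conjugates the exponential, so the
  sum is twice the cosine series.\<close>

lemma circle_polylog_sym_sums:
  assumes "0 < t" "t < 1" "1 \<le> j"
  shows "(\<lambda>k. complex_of_real (2 * cos (2 * pi * (real (Suc k) * t)) / real (Suc k) ^ j)) sums
           circle_polylog_sym j t"
proof -
  have "cis (2 * pi * t) ^ Suc k / of_nat (Suc k) ^ j + cis (2 * pi * (1 - t)) ^ Suc k / of_nat (Suc k) ^ j =
     complex_of_real (2 * cos (2 * pi * (real (Suc k) * t)) / real (Suc k) ^ j)" for k
  proof -
    have "cis (2 * pi * (1 - t)) = cis (- (2 * pi * t))"
      by (simp add: complex_eq_iff right_diff_distrib cos_diff sin_diff)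
    then have "cis (2 * pi * t) ^ Suc k + cis (2 * pi * (1 - t)) ^ Suc k =
      cis (real (Suc k) * (2 * pi * t)) + cis (real (Suc k) * (- (2 * pi * t)))"
      by (simp only: Complex.DeMoivre)
    also have "\<dots> = complex_of_real (2 * cos (2 * pi * (real (Suc k) * t)))"
      by (simp add: complex_eq_iff mult_ac del: of_nat_Suc)
    finally show ?thesis
      by (simp only: add_divide_distrib[symmetric] of_real_divide of_real_power of_real_of_nat_eq)
  qed
  moreover have "(\<lambda>k. cis (2 * pi * t) ^ Suc k / of_nat (Suc k) ^ j + cis (2 * pi * (1 - t)) ^ Suc k / of_nat (Suc k) ^ j)
      sums circle_polylog_sym j t"
    unfolding circle_polylog_sym_def using assms by (intro sums_add circle_polylog_sums) auto
  ultimately show ?thesis by (simp only:)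
qed

text \<open>The factor is the square of 2 pi i. The lowered exponent must still be at least 1, so
  exponent 1 itself needs another route.\<close>

lemma circle_polylog_sym_derivs:
  assumes "0 < t" "t < 1" "1 \<le> j"
  shows "(circle_polylog_sym (Suc (Suc j)) has_vector_derivative
      2 * of_real pi * \<i> * (circle_polylog (Suc j) t - circle_polylog (Suc j) (1 - t))) (at t)" (is ?th1)
    and "((\<lambda>t. 2 * of_real pi * \<i> * (circle_polylog (Suc j) t - circle_polylog (Suc j) (1 - t))) has_vector_derivative
      - of_real ((2 * pi)\<^sup>2) * circle_polylog_sym j t) (at t)" (is ?th2)
proof -
  have D: "(circle_polylog (Suc j) has_vector_derivative 2 * of_real pi * \<i> * circle_polylog j t) (at t)"
    "((\<lambda>t. circle_polylog (Suc j) (1 - t)) has_vector_derivative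
       - (2 * of_real pi * \<i> * circle_polylog j (1 - t))) (at t)" if "1 \<le> j" for j
    using assms that by (intro circle_polylog_has_vector_derivative has_vector_derivative_reflect; simp)+
  have "(circle_polylog_sym (Suc (Suc j)) has_vector_derivative
      2 * of_real pi * \<i> * circle_polylog (Suc j) t + - (2 * of_real pi * \<i> * circle_polylog (Suc j) (1 - t))) (at t)"
    unfolding circle_polylog_sym_def[abs_def] by (rule has_vector_derivative_add[OF D]) auto
  then show ?th1 by (simp add: algebra_simps)
  have "((\<lambda>t. 2 * of_real pi * \<i> * (circle_polylog (Suc j) t - circle_polylog (Suc j) (1 - t))) has_vector_derivative
      2 * of_real pi * \<i> * (2 * of_real pi * \<i> * circle_polylog j t - - (2 * of_real pi * \<i> * circle_polylog j (1 - t)))) (at t)"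
    by (rule has_vector_derivative_mult_right[OF has_vector_derivative_diff[OF D]]) (use assms in auto)
  then show ?th2
    by (simp add: circle_polylog_sym_def power2_eq_square algebra_simps)
qed

text \<open>An odd exponent makes the factor equal to \<open>2 powr s\<close> at
  \<open>s = - 2 * k\<close>, the one on the zeta side.\<close>

lemma circle_polylog_sym_duplication:
  assumes "0 < t" "t < 1/2"
  shows "circle_polylog_sym (2 * k + 1) t + circle_polylog_sym (2 * k + 1) (t + 1/2) =
           1 / 2 ^ (2 * k) * circle_polylog_sym (2 * k + 1) (2 * t)"
proof -
  have q: "2 / 2 ^ (2 * k + 1) = (1 / 2 ^ (2 * k) :: complex)" by simp
  have "circle_polylog_sym (2 * k + 1) t + circle_polylog_sym (2 * k + 1) (t + 1/2) =
      2 / 2 ^ (2 * k + 1) * circle_polylog (2 * k + 1) (2 * t) +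
      2 / 2 ^ (2 * k + 1) * circle_polylog (2 * k + 1) (1 - 2 * t)"
    unfolding circle_polylog_sym_def
    by (rule symmetrize_duplication[where F = "\<lambda>x. 2 / 2 ^ (2 * k + 1) * circle_polylog (2 * k + 1) x",
          OF circle_polylog_duplication assms]) auto
  then show ?thesis
    unfolding q circle_polylog_sym_def by (simp only: distrib_left)
qed

text \<open>Both sides equal - 2 ln (2 sin (pi t)): the left through the modulus of 1 - exp(2 pi i
  t), the right through the reflection formula. The Gamma form is wanted because its second
  derivative is a trigamma sum.\<close>

lemma circle_polylog_sym_1:
  assumes t: "0 < t" "t < 1"
  shows "circle_polylog_sym 1 t =
           complex_of_real (2 * (ln_Gamma t + ln_Gamma (1 - t) - ln (2 * pi)))"
proof -
  have sin_pos: "0 < sin (pi * t)" using t by (intro sin_gt_zero) auto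
  have ne: "1 - cis (2 * pi * t) \<noteq> 0" using cis_2pi_neq_1[OF t] by simp
  have cnj: "1 - cis (2 * pi * (1 - t)) = cnj (1 - cis (2 * pi * t))"
    by (simp add: complex_eq_iff right_diff_distrib cos_diff sin_diff)
  \<comment> \<open>Keeps the argument off the branch cut, so that \<open>Ln\<close> commutes with
    conjugation.\<close>
  have pos: "0 < Re (1 - cis (2 * pi * t))"
  proof -
    have "cos (2 * pi * t) = 1 - 2 * (sin (pi * t))\<^sup>2"
      using cos_double_sin[of "pi * t"] by (simp add: mult_ac)
    then show ?thesis using sin_pos by simp
  qed
  have norm: "cmod (1 - cis (2 * pi * t)) = 2 * sin (pi * t)"
  proof (rule power2_eq_imp_eq)
    have c: "cos (2 * pi * t) = 1 - 2 * (sin (pi * t))\<^sup>2"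
      using cos_double_sin[of "pi * t"] by (simp add: mult_ac)
    have "(cmod (1 - cis (2 * pi * t)))\<^sup>2 = (1 - cos (2 * pi * t))\<^sup>2 + (sin (2 * pi * t))\<^sup>2"
      by (simp add: cmod_power2)
    also have "\<dots> = 2 - 2 * cos (2 * pi * t)"
      using sin_cos_squared_add[of "2 * pi * t"] by (simp add: power2_diff)
    finally show "(cmod (1 - cis (2 * pi * t)))\<^sup>2 = (2 * sin (pi * t))\<^sup>2"
      by (simp add: c power_mult_distrib)
  qed (use sin_pos in auto)
  have "circle_polylog 1 (1 - t) = - Ln (cnj (1 - cis (2 * pi * t)))"
    using t circle_polylog_1[of "1 - t"] cnj by simp
  moreover have "cnj (Ln (1 - cis (2 * pi * t))) = Ln (cnj (1 - cis (2 * pi * t)))"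
    using pos by (intro cnj_Ln) (unfold complex_nonpos_Reals_iff, linarith)
  ultimately have "circle_polylog_sym 1 t = - (Ln (1 - cis (2 * pi * t)) + cnj (Ln (1 - cis (2 * pi * t))))"
    by (simp only: circle_polylog_sym_def circle_polylog_1[OF t]) simp
  also have "\<dots> = complex_of_real (- 2 * ln (2 * sin (pi * t)))"
    using Re_Ln[OF ne] by (simp add: complex_add_cnj norm)
  also have "- 2 * ln (2 * sin (pi * t)) = 2 * (ln_Gamma t + ln_Gamma (1 - t) - ln (2 * pi))"
  proof -
    have "complex_of_real (Gamma t * Gamma (1 - t)) = complex_of_real (pi / sin (pi * t))"
      using Gamma_reflection_complex[of "of_real t"]
      by (simp flip: Gamma_complex_of_real sin_of_real)
    then have "Gamma t * Gamma (1 - t) = pi / sin (pi * t)" by (simp only: of_real_eq_iff)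
    then have "ln (Gamma t * Gamma (1 - t)) = ln (pi / sin (pi * t))" by simp
    moreover have "0 < Gamma t" "0 < Gamma (1 - t)"
      using t by (simp_all add: Gamma_real_pos)
    ultimately show ?thesis
      using t sin_pos by (simp add: ln_Gamma_real_pos ln_mult ln_div)
  qed
  finally show ?thesis .
qed

text \<open>Termwise differentiation would give divergent series; Digamma and trigamma take their
  place, and the trigamma series is the Hurwitz series at s = 2.\<close>

lemma circle_polylog_sym_1_derivs:
  assumes t: "0 < t" "t < 1"
  shows "(circle_polylog_sym 1 has_vector_derivative
      complex_of_real (2 * (Digamma t - Digamma (1 - t)))) (at t)"
    and "((\<lambda>t. complex_of_real (2 * (Digamma t - Digamma (1 - t)))) has_vector_derivative
      2 * hurwitz_reg_sym 2 t) (at t)"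
proof -
  have nn: "t \<notin> \<int>\<^sub>\<le>\<^sub>0" "1 - t \<notin> \<int>\<^sub>\<le>\<^sub>0"
    using t by (auto dest: nonpos_Ints_nonpos)
  have "((\<lambda>t. 2 * (ln_Gamma t + ln_Gamma (1 - t) - ln (2 * pi))) has_real_derivative
     2 * (Digamma t - Digamma (1 - t))) (at t)"
    using t by (auto intro!: derivative_eq_intros)
  then have D: "((\<lambda>t. complex_of_real (2 * (ln_Gamma t + ln_Gamma (1 - t) - ln (2 * pi)))) has_vector_derivative
     complex_of_real (2 * (Digamma t - Digamma (1 - t)))) (at t)"
    by (rule has_vector_derivative_of_real)
  show "(circle_polylog_sym 1 has_vector_derivative
      complex_of_real (2 * (Digamma t - Digamma (1 - t)))) (at t)"
    by (rule has_vector_derivative_transform_within_open[OF D, of "{0<..<1}"])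
      (use t circle_polylog_sym_1 in auto)
  have "((\<lambda>t. 2 * (Digamma t - Digamma (1 - t))) has_real_derivative
     2 * (Polygamma 1 t + Polygamma 1 (1 - t))) (at t)"
    using nn by (auto intro!: derivative_eq_intros)
  then have "((\<lambda>t. complex_of_real (2 * (Digamma t - Digamma (1 - t)))) has_vector_derivative
     complex_of_real (2 * (Polygamma 1 t + Polygamma 1 (1 - t)))) (at t)"
    by (rule has_vector_derivative_of_real)
  \<comment> \<open>At s = 2 the regularizing factor \<open>s - 1\<close> is 1.\<close>
  moreover have "complex_of_real (Polygamma 1 a) = hurwitz_reg 2 a" if "0 < a" for a
  proof -
    have "(\<lambda>k. inverse ((a + real k) ^ Suc 1)) sums ((-1) ^ Suc 1 * Polygamma 1 a / fact 1)"
      using that by (intro Polygamma_LIMSEQ) auto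
    then have "(\<lambda>k. complex_of_real (inverse ((a + real k) ^ 2))) sums complex_of_real (Polygamma 1 a)"
      by (subst sums_of_real_iff) (simp add: numeral_2_eq_2)
    moreover have "complex_of_real (inverse ((a + real k) ^ 2)) = complex_of_real (real k + a) powr (- 2)" for k
    proof -
      have "complex_of_real (real k + a) \<noteq> 0"
        using that by (subst of_real_eq_0_iff) auto
      then show ?thesis
        using powr_complexpow[of "complex_of_real (real k + a)" 2]
        by (simp add: powr_minus add.commute)
    qed
    moreover have "(\<lambda>k. complex_of_real (real k + a) powr (- 2)) sums hurwitz_series 2 a"
      using that by (intro hurwitz_series_sums) auto
    ultimately show ?thesis
      using that sums_unique2 by (fastforce simp: hurwitz_reg_eq_series)
  qed
  ultimately show "((\<lambda>t. complex_of_real (2 * (Digamma t - Digamma (1 - t)))) has_vector_derivative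
      2 * hurwitz_reg_sym 2 t) (at t)"
    using t by (simp add: hurwitz_reg_sym_def)
qed

section \<open>Comparison of the two sides\<close>

text \<open>The constants are forced by the two recursions: c 0 = -1/2 from the trigamma comparison,
  and c (k + 1) = - (2k + 3) (2k + 2) c k / (2 pi)^2 from the second derivatives.\<close>

lemma hurwitz_reg_deriv_sym_minus_even:
  "0 < a \<Longrightarrow> a < 1 \<Longrightarrow> hurwitz_reg_deriv_sym (- of_nat (2 * k)) a =
     of_real ((-1) ^ Suc k * fact (2 * k + 1) / (2 * pi) ^ (2 * k) / 2) * circle_polylog_sym (2 * k + 1) a"
proof (induction k arbitrary: a)
  define c :: "nat \<Rightarrow> complex" where
    "c k = of_real ((-1) ^ Suc k * fact (2 * k + 1) / (2 * pi) ^ (2 * k) / 2)" for k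
  \<comment> \<open>The \<open>ln 2\<close> term is gone because \<open>hurwitz_reg_sym\<close>
    vanishes at \<open>2 * x\<close>; the two duplication factors are equal.\<close>
  have dup: "hurwitz_reg_deriv_sym (- of_nat (2 * k)) x - c k * circle_polylog_sym (2 * k + 1) x +
      (hurwitz_reg_deriv_sym (- of_nat (2 * k)) (x + 1/2) - c k * circle_polylog_sym (2 * k + 1) (x + 1/2)) =
      1 / 2 ^ (2 * k) * (hurwitz_reg_deriv_sym (- of_nat (2 * k)) (2 * x) - c k * circle_polylog_sym (2 * k + 1) (2 * x))"
    if x: "0 < x" "x < 1/2" for x k
  proof -
    have "hurwitz_reg_deriv_sym (- of_nat (2 * k)) x + hurwitz_reg_deriv_sym (- of_nat (2 * k)) (x + 1/2) =
      1 / 2 ^ (2 * k) * hurwitz_reg_deriv_sym (- of_nat (2 * k)) (2 * x)"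
      using hurwitz_reg_sym_duplication(2)[OF x, of "- of_nat (2 * k)"] x
        hurwitz_reg_sym_minus_even[of "2 * x" k]
      by (simp only: two_powr_minus_even) simp
    moreover have "u - c k * v + (u' - c k * v') = (u + u') - c k * (v + v')" for u u' v v'
      by (simp add: algebra_simps)
    moreover have "q * (u - c k * v) = q * u - c k * (q * v)" for q u v
      by (simp add: algebra_simps)
    ultimately show ?thesis
      using circle_polylog_sym_duplication[OF x, of k] by (simp only:)
  qed
  have sym: "hurwitz_reg_deriv_sym s (1 - x) - d * circle_polylog_sym j (1 - x) =
      hurwitz_reg_deriv_sym s x - d * circle_polylog_sym j x" for s d j x
    by (simp add: hurwitz_reg_deriv_sym_def circle_polylog_sym_def)
  {
    case 0
    define s :: complex where "s = - of_nat (2 * 0)"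
    define h where "h x = hurwitz_reg_deriv_sym s x - c 0 * circle_polylog_sym (2 * 0 + 1) x" for x
    have "h a = 0"
    proof (rule symmetric_distribution_eq_zero[where q = "1 / 2 ^ (2 * 0)" and h' = "\<lambda>x.
         - (hurwitz_reg (s + 1) x - hurwitz_reg (s + 1) (1 - x))
         - (s - 1) * (hurwitz_reg_deriv (s + 1) x - hurwitz_reg_deriv (s + 1) (1 - x))
         - c 0 * complex_of_real (2 * (Digamma x - Digamma (1 - x)))"])
      fix x :: real assume x: "0 < x" "x < 1"
      show "(h has_vector_derivative
         - (hurwitz_reg (s + 1) x - hurwitz_reg (s + 1) (1 - x))
         - (s - 1) * (hurwitz_reg_deriv (s + 1) x - hurwitz_reg_deriv (s + 1) (1 - x))
         - c 0 * complex_of_real (2 * (Digamma x - Digamma (1 - x)))) (at x)"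
        using has_vector_derivative_diff[OF hurwitz_reg_deriv_sym_derivs(1)[OF x]
            has_vector_derivative_mult_right[OF circle_polylog_sym_1_derivs(1)[OF x]]]
        unfolding h_def[abs_def] by simp
      \<comment> \<open>At s = 0 only \<open>- hurwitz_reg_sym 2 x\<close> survives, and
        \<open>c 0 = -1/2\<close> is the value that cancels it.\<close>
      have "(2 * s - 1) * hurwitz_reg_sym (s + 2) x + (s - 1) * s * hurwitz_reg_deriv_sym (s + 2) x
        - c 0 * (2 * hurwitz_reg_sym 2 x) = 0"
        by (simp add: s_def c_def)
      with has_vector_derivative_diff[OF hurwitz_reg_deriv_sym_derivs(2)[OF x]
            has_vector_derivative_mult_right[OF circle_polylog_sym_1_derivs(2)[OF x]], of s "c 0"]
      show "((\<lambda>x. - (hurwitz_reg (s + 1) x - hurwitz_reg (s + 1) (1 - x))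
         - (s - 1) * (hurwitz_reg_deriv (s + 1) x - hurwitz_reg_deriv (s + 1) (1 - x))
         - c 0 * complex_of_real (2 * (Digamma x - Digamma (1 - x)))) has_vector_derivative 0) (at x)"
        by (simp only:)
      show "h (1 - x) = h x" unfolding h_def by (rule sym)
    next
      show "h x + h (x + 1/2) = 1 / 2 ^ (2 * 0) * h (2 * x)" if "0 < x" "x < 1/2" for x
        unfolding h_def s_def using that by (rule dup)
    qed (use 0 inverse_two_power_neq_two in auto)
    then show ?case by (simp only: h_def c_def s_def right_minus_eq)
  next
    case (Suc k)
    define s :: complex where "s = - of_nat (2 * Suc k)"
    have s2: "s + 2 = - of_nat (2 * k)" by (simp add: s_def)
    define h where "h x = hurwitz_reg_deriv_sym s x - c (Suc k) * circle_polylog_sym (2 * Suc k + 1) x" for x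
    have j: "2 * Suc k + 1 = Suc (Suc (2 * k + 1))" "1 \<le> 2 * k + 1" by simp_all
    have "h a = 0"
    proof (rule symmetric_distribution_eq_zero[where q = "1 / 2 ^ (2 * Suc k)" and h' = "\<lambda>x.
         - (hurwitz_reg (s + 1) x - hurwitz_reg (s + 1) (1 - x))
         - (s - 1) * (hurwitz_reg_deriv (s + 1) x - hurwitz_reg_deriv (s + 1) (1 - x))
         - c (Suc k) * (2 * of_real pi * \<i> *
             (circle_polylog (Suc (2 * k + 1)) x - circle_polylog (Suc (2 * k + 1)) (1 - x)))"])
      fix x :: real assume x: "0 < x" "x < 1"
      show "(h has_vector_derivative
         - (hurwitz_reg (s + 1) x - hurwitz_reg (s + 1) (1 - x))
         - (s - 1) * (hurwitz_reg_deriv (s + 1) x - hurwitz_reg_deriv (s + 1) (1 - x))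
         - c (Suc k) * (2 * of_real pi * \<i> *
             (circle_polylog (Suc (2 * k + 1)) x - circle_polylog (Suc (2 * k + 1)) (1 - x)))) (at x)"
        unfolding h_def[abs_def] j(1)
        by (rule has_vector_derivative_diff[OF hurwitz_reg_deriv_sym_derivs(1)[OF x]
            has_vector_derivative_mult_right[OF circle_polylog_sym_derivs(1)[OF x j(2)]]])
      have "(2 * s - 1) * hurwitz_reg_sym (s + 2) x + (s - 1) * s * hurwitz_reg_deriv_sym (s + 2) x
        - c (Suc k) * (- of_real ((2 * pi)\<^sup>2) * circle_polylog_sym (2 * k + 1) x) = 0"
      proof -
        \<comment> \<open>The recursion that determines \<open>c\<close>, with
          \<open>(s - 1) * s = (2k + 3) (2k + 2)\<close>.\<close>
        have "(s - 1) * s * c k = - c (Suc k) * of_real ((2 * pi)\<^sup>2)"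
        proof -
          have ss: "(s - 1) * s = of_real (real (2 * k + 3) * real (2 * k + 2))"
            by (simp add: s_def algebra_simps)
          have f: "fact (2 * Suc k + 1) = real (2 * k + 3) * real (2 * k + 2) * fact (2 * k + 1)"
            by (simp add: algebra_simps)
          have p: "(2 * pi) ^ (2 * Suc k) = (2 * pi)\<^sup>2 * (2 * pi) ^ (2 * k)"
            by (simp add: power2_eq_square)
          have "real (2 * k + 3) * real (2 * k + 2) * ((-1) ^ Suc k * fact (2 * k + 1) / (2 * pi) ^ (2 * k) / 2) =
             - ((-1) ^ Suc (Suc k) * fact (2 * Suc k + 1) / (2 * pi) ^ (2 * Suc k) / 2) * (2 * pi)\<^sup>2"
          proof -
            \<comment> \<open>Factorials and powers are replaced by opaque variables so that
              simplification does not expand them.\<close>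
            have "X * (\<sigma> * \<phi> / p / 2) = - (- 1 * \<sigma> * (X * \<phi>) / (P * p) / 2) * P"
              if "P \<noteq> 0" "p \<noteq> 0" for X \<sigma> \<phi> p P :: real
              using that by (simp add: field_simps)
            then show ?thesis
              unfolding f p power_Suc[of "- 1" "Suc k"] by this simp_all
          qed
          then show ?thesis unfolding ss c_def of_real_mult[symmetric] of_real_minus[symmetric]
            by (simp only:)
        qed
        moreover have "hurwitz_reg_sym (s + 2) x = 0"
          unfolding s2 using x by (rule hurwitz_reg_sym_minus_even)
        moreover have "hurwitz_reg_deriv_sym (s + 2) x = c k * circle_polylog_sym (2 * k + 1) x"
          unfolding s2 c_def using x by (rule Suc.IH)
        ultimately show ?thesis by (simp add: mult.assoc[symmetric])
      qed
      with has_vector_derivative_diff[OF hurwitz_reg_deriv_sym_derivs(2)[OF x]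
            has_vector_derivative_mult_right[OF circle_polylog_sym_derivs(2)[OF x j(2)]], of s "c (Suc k)"]
      show "((\<lambda>x. - (hurwitz_reg (s + 1) x - hurwitz_reg (s + 1) (1 - x))
         - (s - 1) * (hurwitz_reg_deriv (s + 1) x - hurwitz_reg_deriv (s + 1) (1 - x))
         - c (Suc k) * (2 * of_real pi * \<i> *
             (circle_polylog (Suc (2 * k + 1)) x - circle_polylog (Suc (2 * k + 1)) (1 - x)))) has_vector_derivative 0) (at x)"
        by (simp only:)
      show "h (1 - x) = h x" unfolding h_def by (rule sym)
    next
      show "h x + h (x + 1/2) = 1 / 2 ^ (2 * Suc k) * h (2 * x)" if "0 < x" "x < 1/2" for x
        unfolding h_def s_def using that by (rule dup)
    qed (use Suc.prems inverse_two_power_neq_two[of "2 * Suc k"] in auto)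
    then show ?case by (simp only: h_def c_def s_def right_minus_eq)
  }
qed

theorem mainTheorem2:
  fixes m :: nat and x :: real
  assumes "0 < m" and "0 < x" and "x < 2 * pi"
  shows "(\<lambda>n. complex_of_real (cos (real (Suc n) * x) / real (Suc n) ^ (2 * m - 1)))
           sums (complex_of_real ((-1) ^ (m - 1) * (2 * pi) ^ (2 * m - 2) / fact (2 * m - 2)) *
                 (hurwitz_zeta_deriv (of_int (2 - 2 * int m)) (1 - x / (2 * pi)) +
                  hurwitz_zeta_deriv (of_int (2 - 2 * int m)) (x / (2 * pi))))"
proof -
  define k where "k = m - 1"
  define a where "a = x / (2 * pi)"
  define s :: complex where "s = - of_nat (2 * k)"
  have a: "0 < a" "a < 1" using assms by (auto simp: a_def)
  have m: "2 * m - 1 = 2 * k + 1" "2 * m - 2 = 2 * k" "of_int (2 - 2 * int m) = s"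
    using assms(1) by (auto simp: k_def s_def of_nat_diff algebra_simps)
  have s1: "s - 1 = - of_nat (2 * k + 1)" by (simp add: s_def)
  have s_ne: "s \<noteq> 1"
  proof
    assume "s = 1"
    then have "- of_nat (2 * k + 1) = (0 :: complex)" using s1 by (metis diff_self)
    then have "2 * k + 1 = 0" by (simp only: neg_equal_0_iff_equal of_nat_eq_0_iff)
    then show False by simp
  qed
  \<comment> \<open>Quotient rule for \<open>hurwitz_reg / (s - 1)\<close>; the second term drops
    out at even nonpositive \<open>s\<close>.\<close>
  have "hurwitz_zeta_deriv s (1 - a) + hurwitz_zeta_deriv s a =
      hurwitz_reg_deriv_sym s a / (s - 1) - hurwitz_reg_sym s a / (s - 1)\<^sup>2"
    using a s_ne by (simp add: hurwitz_zeta_deriv_eq_reg hurwitz_reg_deriv_sym_def hurwitz_reg_sym_def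
        add_divide_distrib)
  also have "\<dots> = hurwitz_reg_deriv_sym s a / (s - 1)"
    using hurwitz_reg_sym_minus_even[OF a, of k] by (simp only: s_def) simp
  also have "\<dots> = of_real ((-1) ^ Suc k * fact (2 * k + 1) / (2 * pi) ^ (2 * k) / 2 / (- real (2 * k + 1))) *
      circle_polylog_sym (2 * k + 1) a"
    unfolding s1 unfolding s_def hurwitz_reg_deriv_sym_minus_even[OF a] by simp
  \<comment> \<open>Dividing by \<open>s - 1 = - (2k + 1)\<close> lowers the factorial and flips the
    sign.\<close>
  also have "(-1) ^ Suc k * fact (2 * k + 1) / (2 * pi) ^ (2 * k) / 2 / (- real (2 * k + 1)) =
      (-1) ^ k * fact (2 * k) / (2 * pi) ^ (2 * k) / 2"
  proof -
    have "fact (2 * k + 1) = real (2 * k + 1) * fact (2 * k)" by simp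
    then show ?thesis by (simp del: of_nat_add of_nat_mult of_nat_Suc)
  qed
  finally have zeta: "hurwitz_zeta_deriv s (1 - a) + hurwitz_zeta_deriv s a =
     of_real ((-1) ^ k * fact (2 * k) / (2 * pi) ^ (2 * k) / 2) * circle_polylog_sym (2 * k + 1) a" .
  \<comment> \<open>The remaining 1/2 compensates the factor 2 between
    \<open>circle_polylog_sym\<close> and the cosine series.\<close>
  have "((-1) ^ k * (2 * pi) ^ (2 * k) / fact (2 * k)) * ((-1) ^ k * fact (2 * k) / (2 * pi) ^ (2 * k) / 2) = 1 / 2"
    by (simp add: power_add[symmetric] mult_2[symmetric])
  then have "of_real ((-1) ^ k * (2 * pi) ^ (2 * k) / fact (2 * k)) *
      (hurwitz_zeta_deriv s (1 - a) + hurwitz_zeta_deriv s a) = of_real (1 / 2) * circle_polylog_sym (2 * k + 1) a"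
    unfolding zeta mult.assoc[symmetric] of_real_mult[symmetric] by (simp only:)
  moreover have "(\<lambda>n. of_real (1 / 2) * complex_of_real (2 * cos (2 * pi * (real (Suc n) * a)) / real (Suc n) ^ (2 * k + 1)))
      sums (of_real (1 / 2) * circle_polylog_sym (2 * k + 1) a)"
    using a by (intro sums_mult circle_polylog_sym_sums) auto
  moreover have "of_real (1 / 2) * complex_of_real (2 * cos (2 * pi * (real (Suc n) * a)) / real (Suc n) ^ (2 * k + 1)) =
      complex_of_real (cos (real (Suc n) * x) / real (Suc n) ^ (2 * k + 1))" for n
    unfolding of_real_mult[symmetric] by (simp add: a_def del: of_nat_Suc)
  ultimately show ?thesis
    unfolding m k_def[symmetric] a_def[symmetric] by (simp only:)
qed

end
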